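(* There is an absolute constant $C>0$ such that the following holds. Let $H$ be a $(D^8,D,\lambda)$-graph for some $D$ and $\lambda$. Define graphs $G_t$, $t\ge1$, by $G_1=H^2$, $G_2=H\otimes H$, and, for $t>2$, $G_t$ is the zig-zag product of $\left(G_{\lceil (t-1)/2\rceil}\otimes G_{\lfloor (t-1)/2\rfloor}\right)^2$ (as the large graph) with $H$ (as the small graph). Then for every $t\ge1$, $G_t$ is a $(D^{8t},D^2,\lambda_t)$-graph for some $\lambda_t\le\lambda+C\lambda^2$ (i.e. $\lambda_t=\lambda+O(\lambda^2)$). Moreover, $\mathrm{Rot}_{G_t}$ can be computed in time $\mathrm{poly}(t,\log D)$ with $\mathrm{poly}(t)$ oracle queries to $\mathrm{Rot}_H$.
   Context: For a positive integer $n$, $[n]=\{1,\dots,n\}$. Graphs are finite, undirected and regular, and may have self-loops and parallel edges. A $D$-regular graph $G$ on $[N]$ is specified by its rotation map $\mathrm{Rot}_G:[N]\times[D]\to[N]\times[D]$: $\mathrm{Rot}_G(v,i)=(w,j)$ means that the $i$-th edge incident to $v$ leads to $w$ and that this edge is the $j$-th edge incident to $w$. Thus $\mathrm{Rot}_G$ is a permutation with $\mathrm{Rot}_G\circ\mathrm{Rot}_G=\mathrm{id}$ (and any such involution specifies a $D$-regular graph). Vertex sets and sets of edge labels may be any finite sets of the right cardinality; when needed they are identified with sets $[n]$ by the standard (efficiently computable) bijections between products of intervals and intervals, e.g. the edge-label set, of size $D^8$, of the squared tensor product is identified with the vertex set of $H$. The normalized adjacency matrix of $G$ is the symmetric $N\times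 N$ matrix with $M_{u,v}=\frac1D|\{(i,j)\in[D]^2:\mathrm{Rot}_G(u,i)=(v,j)\}|$. The second largest eigenvalue in absolute value is $\lambda(G)=\max_{\alpha\perp 1_N,\,\alpha\ne0}\|M\alpha\|/\|\alpha\|$, where $1_N$ is the all-ones vector and the norm is Euclidean (with $\lambda(G)=0$ if $N=1$). An $(N,D,\lambda)$-graph is a $D$-regular graph on $N$ vertices with $\lambda(G)\le\lambda$. Square: $G^2$ is the $D^2$-regular graph on the vertices of $G$ with $\mathrm{Rot}_{G^2}(v_0,(k_1,k_2))=(v_2,(\ell_2,\ell_1))$, where $(v_1,\ell_1)=\mathrm{Rot}_G(v_0,k_1)$ and $(v_2,\ell_2)=\mathrm{Rot}_G(v_1,k_2)$. Tensor product: for $G_1$ ($D_1$-regular on $[N_1]$) and $G_2$ ($D_2$-regular on $[N_2]$), $G_1\otimes G_2$ is the $D_1D_2$-regular graph on $[N_1]\times[N_2]$ with $\mathrm{Rot}_{G_1\otimes G_2}((v,w),(i,j))=((v',w'),(i',j'))$, where $(v',i')=\mathrm{Rot}_{G_1}(v,i)$ and $(w',j')=\mathrm{Rot}_{G_2}(w,j)$. Zig-zag product: for a $D_1$-regular graph $G_1$ on $[N_1]$ (the large graph) and a $D_2$-regular graph $G_2$ on $[D_1]$ (the small graph), it is the $D_2^2$-regular graph on $[N_1]\times[D_1]$, with edge labels in $[D_2]\times[D_2]$, whose rotation map sends $((v,k),(i,j))$ to $((w,\ell),(j',i'))$, where $(k',i')=\mathrm{Rot}_{G_2}(k,i)$,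 then $(w,\ell')=\mathrm{Rot}_{G_1}(v,k')$, then $(\ell,j')=\mathrm{Rot}_{G_2}(\ell',j)$. Computation: $\mathrm{poly}(\cdot)$ denotes a fixed unspecified polynomial in its arguments. An algorithm with oracle access to a function may evaluate it on inputs of its choice at the cost of one time step per evaluation. One single algorithm, given the parameters as additional input, works for all graphs; the time and query counts are per evaluation of the rotation map. *)

theory Defs
  imports
    Complex_Main
    "HOL-Analysis.L2_Norm"
    "HOL-Library.Log_Nat"
    "HOL-Computational_Algebra.Polynomial"
begin

section \<open>Graphs given by rotation maps\<close>

text \<open>
  The set \<open>[n]\<close> is represented by \<open>{..<n}\<close>, so that the standard bijection between
  \<open>[m] \<times> [n]\<close> and \<open>[m * n]\<close> is the usual positional one, \<open>(a, b) \<mapsto> a * n + b\<close>.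
  The value of \<open>rot\<close> outside \<open>[N] \<times> [D]\<close> is irrelevant.
\<close>

record rgraph =
  nv :: nat
  deg :: nat
  rot :: "nat \<times> nat \<Rightarrow> nat \<times> nat"

definition rdom :: "rgraph \<Rightarrow> (nat \<times> nat) set" where
  "rdom G = {..<nv G} \<times> {..<deg G}"

definition regular_graph :: "rgraph \<Rightarrow> bool" where
  "regular_graph G \<longleftrightarrow>
     nv G \<ge> 1 \<and> deg G \<ge> 1 \<and> (\<forall>x \<in> rdom G. rot G x \<in> rdom G \<and> rot G (rot G x) = x)"

definition adj :: "rgraph \<Rightarrow> nat \<Rightarrow> nat \<Rightarrow> real" where
  "adj G u v =
     real (card {(i, j). i < deg G \<and> j < deg G \<and> rot G (u, i) = (v, j)}) / real (deg G)"

text \<open>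
  Vectors and matrices are functions, of which only the entries below \<open>nv G\<close> matter.
  The supremum is over a continuous, scale-invariant quotient on a finite-dimensional
  space, hence is a maximum.
\<close>

definition second_eigenvalue :: "rgraph \<Rightarrow> real" where
  "second_eigenvalue G =
     (if nv G = 1 then 0
      else (SUP \<alpha> \<in> {\<alpha> :: nat \<Rightarrow> real. (\<Sum>v<nv G. \<alpha> v * 1) = 0 \<and> (\<exists>v<nv G. \<alpha> v \<noteq> 0)}.
              L2_set (\<lambda>u. \<Sum>v<nv G. adj G u v * \<alpha> v) {..<nv G} / L2_set \<alpha> {..<nv G}))"

definition ndl_graph :: "nat \<Rightarrow> nat \<Rightarrow> real \<Rightarrow> rgraph \<Rightarrow> bool" where
  "ndl_graph N D l G \<longleftrightarrow>
     regular_graph G \<and> nv G = N \<and> deg G = D \<and> second_eigenvalue G \<le> l"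

section \<open>Graph operations\<close>

definition enc :: "nat \<Rightarrow> nat \<times> nat \<Rightarrow> nat" where
  "enc n = (\<lambda>(a, b). a * n + b)"

definition dec :: "nat \<Rightarrow> nat \<Rightarrow> nat \<times> nat" where
  "dec n x = (x div n, x mod n)"

definition square :: "rgraph \<Rightarrow> rgraph" where
  "square G =
     \<lparr> nv = nv G,
       deg = deg G ^ 2,
       rot = (\<lambda>(v0, k).
         let (k1, k2) = dec (deg G) k;
             (v1, l1) = rot G (v0, k1);
             (v2, l2) = rot G (v1, k2)
         in (v2, enc (deg G) (l2, l1))) \<rparr>"

definition tensor :: "rgraph \<Rightarrow> rgraph \<Rightarrow> rgraph" where
  "tensor G1 G2 =
     \<lparr> nv = nv G1 * nv G2,
       deg = deg G1 * deg G2,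
       rot = (\<lambda>(x, k).
         let (v, w) = dec (nv G2) x;
             (i, j) = dec (deg G2) k;
             (v', i') = rot G1 (v, i);
             (w', j') = rot G2 (w, j)
         in (enc (nv G2) (v', w'), enc (deg G2) (i', j'))) \<rparr>"

text \<open>Meaningful only if \<open>nv G2 = deg G1\<close>; \<open>G1\<close> is the large graph.\<close>

definition zigzag :: "rgraph \<Rightarrow> rgraph \<Rightarrow> rgraph" where
  "zigzag G1 G2 =
     \<lparr> nv = nv G1 * deg G1,
       deg = deg G2 ^ 2,
       rot = (\<lambda>(x, e).
         let (v, k) = dec (deg G1) x;
             (i, j) = dec (deg G2) e;
             (k', i') = rot G2 (k, i);
             (w, l') = rot G1 (v, k');
             (l, j') = rot G2 (l', j)
         in (enc (deg G1) (w, l), enc (deg G2) (j', i'))) \<rparr>"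

text \<open>The value at \<open>t = 0\<close> is a dummy.\<close>

function graph_seq :: "rgraph \<Rightarrow> nat \<Rightarrow> rgraph" where
  "graph_seq H t =
     (if t \<le> 1 then square H
      else if t = 2 then tensor H H
      else zigzag
             (square (tensor (graph_seq H (nat \<lceil>(real t - 1) / 2\<rceil>))
                             (graph_seq H (nat \<lfloor>(real t - 1) / 2\<rfloor>))))
             H)"
  by pat_completeness auto

termination
proof (relation "measure snd")
  fix H :: rgraph and t :: nat
  assume "\<not> t \<le> 1"
  then have t: "t \<ge> 2" by simp
  have "\<lceil>(real t - 1) / 2\<rceil> \<le> int t - 1"
    unfolding ceiling_le_iff using t by (simp add: field_simps)
  moreover have "\<lfloor>(real t - 1) / 2\<rfloor> \<le> \<lceil>(real t - 1) / 2\<rceil>"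
    by (rule floor_le_ceiling)
  ultimately have *: "nat \<lceil>(real t - 1) / 2\<rceil> < t" "nat \<lfloor>(real t - 1) / 2\<rfloor> < t"
    using t by linarith+
  show "((H, nat \<lceil>(real t - 1) / 2\<rceil>), H, t) \<in> measure snd" using *(1) by simp
  show "((H, nat \<lfloor>(real t - 1) / 2\<rfloor>), H, t) \<in> measure snd" using *(2) by simp
qed simp

declare graph_seq.simps [simp del]

section \<open>Oracle computation\<close>

text \<open>
  Programs are while-programs for a random access machine whose memory cells hold natural
  numbers.  Time is measured by the logarithmic cost criterion: every occurrence of a
  subexpression that is evaluated (including addresses and operands) costs one plus the bit
  length of its value, and every command executed costs one more, where a loop is charged once
  for every evaluation of its condition.  Apart from the evaluation of its two arguments, an
  oracle query takes a single time step.  A query outside the domain of the oracle has no result.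
\<close>

datatype arith_op = Plus | Minus | Times | Quot | Rem

datatype expr = Lit nat | Cell expr | Arith arith_op expr expr

datatype prog =
    Skip
  | Store expr expr
  | Seq prog prog
  | Cond expr prog prog
  | Loop expr prog
  | Query expr expr nat nat

type_synonym mem = "nat \<Rightarrow> nat"

fun arith :: "arith_op \<Rightarrow> nat \<Rightarrow> nat \<Rightarrow> nat" where
  "arith Plus a b = a + b"
| "arith Minus a b = a - b"
| "arith Times a b = a * b"
| "arith Quot a b = a div b"
| "arith Rem a b = a mod b"

fun val :: "mem \<Rightarrow> expr \<Rightarrow> nat" where
  "val s (Lit n) = n"
| "val s (Cell e) = s (val s e)"
| "val s (Arith f a b) = arith f (val s a) (val s b)"

abbreviation bits :: "nat \<Rightarrow> nat" where
  "bits n \<equiv> floorlog 2 n"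

fun cost :: "mem \<Rightarrow> expr \<Rightarrow> nat" where
  "cost s (Lit n) = 1 + bits n"
| "cost s (Cell e) = cost s e + 1 + bits (val s (Cell e))"
| "cost s (Arith f a b) = cost s a + cost s b + 1 + bits (val s (Arith f a b))"

text \<open>
  \<open>run orc p s T Q s'\<close>: started in memory \<open>s\<close>, the program \<open>p\<close> halts in memory \<open>s'\<close>
  after \<open>T\<close> time steps, of which \<open>Q\<close> are oracle queries.
\<close>

inductive run ::
  "(nat \<times> nat \<rightharpoonup> nat \<times> nat) \<Rightarrow> prog \<Rightarrow> mem \<Rightarrow> nat \<Rightarrow> nat \<Rightarrow> mem \<Rightarrow> bool"
  for orc where
  Skip: "run orc Skip s 1 0 s"
| Store: "run orc (Store a e) s (cost s a + cost s e + 1) 0 (s(val s a := val s e))"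
| Seq: "run orc p s T Q s' \<Longrightarrow> run orc p' s' T' Q' s'' \<Longrightarrow>
    run orc (Seq p p') s (T + T' + 1) (Q + Q') s''"
| CondTrue: "val s e \<noteq> 0 \<Longrightarrow> run orc p s T Q s' \<Longrightarrow>
    run orc (Cond e p p') s (cost s e + T + 1) Q s'"
| CondFalse: "val s e = 0 \<Longrightarrow> run orc p' s T Q s' \<Longrightarrow>
    run orc (Cond e p p') s (cost s e + T + 1) Q s'"
| LoopTrue: "val s e \<noteq> 0 \<Longrightarrow> run orc p s T Q s' \<Longrightarrow> run orc (Loop e p) s' T' Q' s'' \<Longrightarrow>
    run orc (Loop e p) s (cost s e + T + T' + 1) (Q + Q') s''"
| LoopFalse: "val s e = 0 \<Longrightarrow> run orc (Loop e p) s (cost s e + 1) 0 s"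
| Query: "orc (val s a, val s b) = Some (y, z) \<Longrightarrow>
    run orc (Query a b m n) s (cost s a + cost s b + 1) 1 (s(m := y, n := z))"

definition rot_oracle :: "rgraph \<Rightarrow> (nat \<times> nat \<rightharpoonup> nat \<times> nat)" where
  "rot_oracle G = (Some \<circ> rot G) |` rdom G"

text \<open>Inputs are placed in cells 0 to 3, outputs are read off cells 0 and 1.\<close>

definition input4 :: "nat \<Rightarrow> nat \<Rightarrow> nat \<Rightarrow> nat \<Rightarrow> mem" where
  "input4 a b c d = (\<lambda>_. 0)(0 := a, 1 := b, 2 := c, 3 := d)"

definition output2 :: "mem \<Rightarrow> nat \<times> nat" where
  "output2 s = (s 0, s 1)"

text \<open>The value \<open>p(x, y)\<close> of a polynomial in two variables.\<close>

definition poly2 :: "real poly poly \<Rightarrow> real \<Rightarrow> real \<Rightarrow> real" where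
  "poly2 p x y = poly (poly p [:x:]) y"

end

theory Submission
  imports Defs
begin

text \<open>
  Spectral part. The zig-zag product walks by \<open>B A B\<close>, where \<open>A\<close> permutes the edges of the large
  graph and \<open>B\<close> acts by the small graph on each cloud. Splitting vectors into cloud means and rests
  gives \<open>\<lambda> \<le> \<lambda>\<^sub>1 + \<lambda>\<^sub>2 + \<lambda>\<^sub>2\<^sup>2\<close>; squaring squares \<open>\<lambda>\<close> and tensoring takes the maximum. If \<open>\<lambda> \<le> 1/5\<close>,
  the bound \<open>\<lambda> + 5 \<lambda>\<^sup>2\<close> is therefore reproduced by the recursion, and otherwise \<open>\<lambda> + 20 \<lambda>\<^sup>2 \<ge> 1\<close>.

  Algorithmic part. A vertex of \<open>G\<^sub>t\<close> is a string of \<open>t\<close> digits in base \<open>D\<^sup>8\<close>, the first ones for the two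
  recursive factors and the last one for the cloud. The rotation map is computed in place on this
  string, with an explicit stack of pending calls. A call of size \<open>n\<close> issues two calls each of
  sizes \<open>n div 2\<close> and \<open>(n - 1) div 2\<close>, so there are \<open>O(t\<^sup>2)\<close> steps and queries, and all numbers have
  \<open>O(t log D)\<close> bits.
\<close>

section \<open>The random walk operator\<close>

text \<open>The second eigenvalue enters only through \<open>expands\<close>, an inequality for the
  averaging operator \<open>walk\<close> on zero-sum vectors: unlike the supremum, it composes under
  squares and products without choosing a maximiser. The obstacle on the machine side is that
  programs have loops but no recursion, and that big-step runs expose no intermediate states. Cost
  and correctness are therefore separated. The body of the main loop is loop-free, so one iteration
  takes at most a constant, fixed by the program text, times the bit length of a bound
  \<open>M\<close> on all cells; only iterations remain to be counted. Working in place is possible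
  because the vertex encoding of a tensor product is concatenation of digit strings, so each factor
  owns an interval of cells. Squaring makes each factor be called twice; since the sizes are about
  half of n, four calls still lead to a quadratic total.\<close>

definition walk :: "rgraph \<Rightarrow> (nat \<Rightarrow> real) \<Rightarrow> nat \<Rightarrow> real" where
  "walk G \<alpha> u = (\<Sum>i<deg G. \<alpha> (fst (rot G (u, i)))) / real (deg G)"

lemma rot_in_rdom:
  assumes "regular_graph G" "u < nv G" "i < deg G"
  shows "fst (rot G (u, i)) < nv G" "snd (rot G (u, i)) < deg G"
  using assms unfolding regular_graph_def rdom_def by (auto simp: mem_Times_iff)

lemma rot_bij:
  assumes "regular_graph G"
  shows "bij_betw (rot G) (rdom G) (rdom G)"
  by (rule bij_betw_byWitness[where f' = "rot G"])
    (use assms in \<open>auto simp: regular_graph_def\<close>)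

lemma sum_rot:
  assumes "regular_graph G"
  shows "(\<Sum>x\<in>rdom G. f (rot G x)) = (\<Sum>x\<in>rdom G. f x)"
  by (rule sum.reindex_bij_betw[OF rot_bij[OF assms]])

text \<open>The rotation map determines the second label from the first, so the pairs counted by
  \<open>adj\<close> are just the edges leaving \<open>u\<close> for \<open>v\<close>; summing over
  \<open>v\<close> leaves one term per edge.\<close>

lemma adj_sum_eq_walk:
  assumes G: "regular_graph G" and u: "u < nv G"
  shows "(\<Sum>v<nv G. adj G u v * \<alpha> v) = walk G \<alpha> u"
proof -
  have card: "card {(i, j). i < deg G \<and> j < deg G \<and> rot G (u, i) = (v, j)}
      = card {i\<in>{..<deg G}. fst (rot G (u, i)) = v}" for v
  proof -
    let ?S = "{(i, j). i < deg G \<and> j < deg G \<and> rot G (u, i) = (v, j)}"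
    let ?f = "\<lambda>i. (i, snd (rot G (u, i)))"
    have "?S = ?f ` {i\<in>{..<deg G}. fst (rot G (u, i)) = v}"
    proof (intro equalityI subsetI)
      fix x assume "x \<in> ?S"
      then show "x \<in> ?f ` {i\<in>{..<deg G}. fst (rot G (u, i)) = v}"
        by (intro image_eqI[of _ _ "fst x"]) (clarsimp, clarsimp)
    next
      fix x assume "x \<in> ?f ` {i\<in>{..<deg G}. fst (rot G (u, i)) = v}"
      then obtain i where i: "x = ?f i" "i < deg G" "fst (rot G (u, i)) = v" by blast
      then show "x \<in> ?S" using rot_in_rdom(2)[OF G u, of i]
        by (cases "rot G (u, i)") simp
    qed
    moreover have "inj_on ?f A" for A by (rule inj_onI) simp
    ultimately show ?thesis by (simp only: card_image)
  qed
  have "(\<Sum>v<nv G. adj G u v * \<alpha> v)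
      = (\<Sum>v<nv G. \<Sum>i<deg G. (if fst (rot G (u, i)) = v then \<alpha> v else 0)) / real (deg G)"
    unfolding adj_def card sum_divide_distrib[of _ "{..<nv G}"]
    by (intro sum.cong) (auto simp: sum.If_cases Int_def conj_commute)
  also have "\<dots> = (\<Sum>i<deg G. \<Sum>v<nv G. (if fst (rot G (u, i)) = v then \<alpha> v else 0)) / real (deg G)"
    by (subst sum.swap) simp
  also have "\<dots> = walk G \<alpha> u"
    unfolding walk_def by (intro arg_cong2[where f = "(/)"] sum.cong refl)
      (use rot_in_rdom(1)[OF G u] in \<open>auto simp: sum.delta\<close>)
  finally show ?thesis .
qed

text \<open>Writing the bilinear form as one sum over the edge ends \<open>rdom G\<close> makes the
  involution \<open>rot G\<close> available as a change of variables.\<close>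

lemma sum_mult_walk:
  assumes G: "regular_graph G"
  shows "(\<Sum>u<nv G. \<beta> u * walk G \<alpha> u)
    = (\<Sum>x\<in>rdom G. \<beta> (fst x) * \<alpha> (fst (rot G x))) / real (deg G)"
  unfolding walk_def rdom_def
  by (simp add: sum.cartesian_product' sum_divide_distrib sum_distrib_left)

lemma walk_symmetric:
  assumes G: "regular_graph G"
  shows "(\<Sum>u<nv G. \<beta> u * walk G \<alpha> u) = (\<Sum>u<nv G. walk G \<beta> u * \<alpha> u)"
proof -
  have "(\<Sum>x\<in>rdom G. \<beta> (fst x) * \<alpha> (fst (rot G x)))
      = (\<Sum>x\<in>rdom G. \<beta> (fst (rot G (rot G x))) * \<alpha> (fst (rot G x)))"
    using G by (intro sum.cong) (auto simp: regular_graph_def)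
  also have "\<dots> = (\<Sum>x\<in>rdom G. \<alpha> (fst x) * \<beta> (fst (rot G x)))"
    by (subst sum_rot[OF G, of "\<lambda>x. \<beta> (fst (rot G x)) * \<alpha> (fst x)"]) (simp add: mult.commute)
  finally show ?thesis
    using sum_mult_walk[OF G, of \<beta> \<alpha>] sum_mult_walk[OF G, of \<alpha> \<beta>] by (simp add: mult.commute)
qed

lemma walk_const:
  assumes "regular_graph G"
  shows "walk G (\<lambda>_. c) u = c"
  using assms by (simp add: walk_def regular_graph_def)

lemma sum_walk:
  assumes "regular_graph G"
  shows "(\<Sum>u<nv G. walk G \<alpha> u) = (\<Sum>u<nv G. \<alpha> u)"
  using walk_symmetric[OF assms, of "\<lambda>_. 1" \<alpha>] by (simp add: walk_const[OF assms])

lemma walk_add: "walk G (\<lambda>x. \<alpha> x + \<beta> x) u = walk G \<alpha> u + walk G \<beta> u"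
  by (simp add: walk_def sum.distrib add_divide_distrib)

section \<open>Norm estimates for the walk operator\<close>

lemma L2_set_le_iff: "L2_set f A \<le> L2_set g B \<longleftrightarrow> (\<Sum>x\<in>A. (f x)\<^sup>2) \<le> (\<Sum>x\<in>B. (g x)\<^sup>2)"
  by (simp add: L2_set_def)

lemma L2_set_sq: "(L2_set f A)\<^sup>2 = (\<Sum>x\<in>A. (f x)\<^sup>2)"
  by (simp add: L2_set_def sum_nonneg)

lemma sum_mult_le_L2: "(\<Sum>x\<in>A. f x * g x) \<le> L2_set f A * L2_set g A"
  by (rule order_trans[OF _ L2_set_mult_ineq])
    (auto intro!: sum_mono simp: abs_mult[symmetric])

text \<open>Cauchy-Schwarz on the space of edge ends: lifting a vector there multiplies its norm by
  the square root of the degree, and composing with \<open>rot G\<close> preserves the norm, so the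
  two roots cancel the division by the degree.\<close>

lemma L2_walk_le:
  assumes G: "regular_graph G"
  shows "L2_set (walk G \<alpha>) {..<nv G} \<le> L2_set \<alpha> {..<nv G}"
proof -
  let ?D = "real (deg G)"
  have D: "?D > 0" using G by (simp add: regular_graph_def)
  have lift: "L2_set (\<lambda>x. f (fst x)) (rdom G) = sqrt ?D * L2_set f {..<nv G}" for f
    unfolding L2_set_def rdom_def
    by (simp add: sum.cartesian_product' sum_distrib_left[symmetric] real_sqrt_mult)
  have "(\<Sum>u<nv G. (walk G \<alpha> u)\<^sup>2) = (\<Sum>u<nv G. walk G \<alpha> u * walk G \<alpha> u)"
    by (simp add: power2_eq_square)
  also have "\<dots> = (\<Sum>x\<in>rdom G. walk G \<alpha> (fst x) * \<alpha> (fst (rot G x))) / ?D"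
    by (rule sum_mult_walk[OF G])
  also have "\<dots> \<le> L2_set (\<lambda>x. walk G \<alpha> (fst x)) (rdom G) * L2_set (\<lambda>x. \<alpha> (fst (rot G x))) (rdom G) / ?D"
    using D by (intro divide_right_mono sum_mult_le_L2) auto
  also have "L2_set (\<lambda>x. \<alpha> (fst (rot G x))) (rdom G) = L2_set (\<lambda>x. \<alpha> (fst x)) (rdom G)"
    unfolding L2_set_def by (subst sum_rot[OF G, of "\<lambda>x. (\<alpha> (fst x))\<^sup>2"]) simp
  also have "L2_set (\<lambda>x. walk G \<alpha> (fst x)) (rdom G) * L2_set (\<lambda>x. \<alpha> (fst x)) (rdom G) / ?D
      = L2_set (walk G \<alpha>) {..<nv G} * L2_set \<alpha> {..<nv G}"
  proof -
    have "r * x * (r * y) / (r * r) = x * y" if "r > 0" for r x y :: real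
      using that by simp
    from this[of "sqrt ?D"] show ?thesis using D by (simp add: lift)
  qed
  finally have "(L2_set (walk G \<alpha>) {..<nv G})\<^sup>2
      \<le> L2_set (walk G \<alpha>) {..<nv G} * L2_set \<alpha> {..<nv G}"
    by (simp add: L2_set_sq)
  then show ?thesis
    using L2_set_nonneg[of "walk G \<alpha>" "{..<nv G}"] L2_set_nonneg[of \<alpha> "{..<nv G}"]
    by (cases "L2_set (walk G \<alpha>) {..<nv G} = 0") (auto simp: power2_eq_square)
qed

text \<open>On a single vertex the inequality reads 0 \<le> 0 whatever \<open>l\<close> is; the
  conjunct \<open>0 \<le> l\<close> then expresses the convention that the second eigenvalue is
  0.\<close>

definition expands :: "rgraph \<Rightarrow> real \<Rightarrow> bool" where
  "expands G l \<longleftrightarrow> 0 \<le> l \<and>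
     (\<forall>\<alpha>. (\<Sum>v<nv G. \<alpha> v) = 0 \<longrightarrow> L2_set (walk G \<alpha>) {..<nv G} \<le> l * L2_set \<alpha> {..<nv G})"

lemma expandsD:
  "expands G l \<Longrightarrow> (\<Sum>v<nv G. \<alpha> v) = 0 \<Longrightarrow> L2_set (walk G \<alpha>) {..<nv G} \<le> l * L2_set \<alpha> {..<nv G}"
  by (simp add: expands_def)

lemma expands_one: "regular_graph G \<Longrightarrow> expands G 1"
  by (simp add: expands_def L2_walk_le)

lemma expands_mono:
  assumes "expands G l" "l \<le> l'"
  shows "expands G l'"
  unfolding expands_def
proof (intro conjI allI impI)
  show "0 \<le> l'" using assms by (simp add: expands_def)
  fix \<alpha> :: "nat \<Rightarrow> real" assume "(\<Sum>v<nv G. \<alpha> v) = 0"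
  from expandsD[OF assms(1) this] show "L2_set (walk G \<alpha>) {..<nv G} \<le> l' * L2_set \<alpha> {..<nv G}"
    by (rule order_trans) (intro mult_right_mono assms L2_set_nonneg)
qed

lemma L2_adj_eq_walk:
  assumes "regular_graph G"
  shows "L2_set (\<lambda>u. \<Sum>v<nv G. adj G u v * \<alpha> v) {..<nv G} = L2_set (walk G \<alpha>) {..<nv G}"
  by (rule L2_set_cong) (simp_all add: adj_sum_eq_walk[OF assms])

text \<open>A real supremum is informative only for a nonempty set that is bounded above:
  contraction bounds the quotients by 1, and two vertices provide a nonzero vector with zero
  sum.\<close>

lemma second_eigenvalue_le_iff:
  assumes G: "regular_graph G"
  shows "second_eigenvalue G \<le> l \<longleftrightarrow> expands G l"
proof (cases "nv G = 1")
  case True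
  have "L2_set (walk G \<alpha>) {..<nv G} \<le> l * L2_set \<alpha> {..<nv G}" if "(\<Sum>v<nv G. \<alpha> v) = 0" for \<alpha>
  proof -
    have "L2_set \<alpha> {..<nv G} = 0" using that True by (simp add: L2_set_def lessThan_Suc)
    then show ?thesis using L2_walk_le[OF G, of \<alpha>] by simp
  qed
  then show ?thesis using True by (auto simp: second_eigenvalue_def expands_def)
next
  case False
  then have n: "nv G \<ge> 2" using G by (simp add: regular_graph_def)
  let ?A = "{\<alpha> :: nat \<Rightarrow> real. (\<Sum>v<nv G. \<alpha> v * 1) = 0 \<and> (\<exists>v<nv G. \<alpha> v \<noteq> 0)}"
  let ?q = "\<lambda>\<alpha>. L2_set (walk G \<alpha>) {..<nv G} / L2_set \<alpha> {..<nv G}"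
  have eq: "second_eigenvalue G = (SUP \<alpha>\<in>?A. ?q \<alpha>)"
    using False by (simp add: second_eigenvalue_def L2_adj_eq_walk[OF G])
  have pos: "L2_set \<alpha> {..<nv G} > 0" if "\<exists>v<nv G. \<alpha> v \<noteq> 0" for \<alpha>
    using that L2_set_eq_0_iff[of "{..<nv G}" \<alpha>] L2_set_nonneg[of \<alpha> "{..<nv G}"]
    by (auto simp: order_less_le)
  have bdd: "bdd_above (?q ` ?A)"
  proof (rule bdd_aboveI2)
    fix \<alpha> assume "\<alpha> \<in> ?A"
    then show "?q \<alpha> \<le> 1" using L2_walk_le[OF G, of \<alpha>] pos[of \<alpha>] by (simp add: divide_le_eq)
  qed
  define \<delta> :: "nat \<Rightarrow> real" where "\<delta> = (\<lambda>v. if v = 0 then 1 else if v = 1 then -1 else 0)"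
  have "(\<Sum>v<nv G. \<delta> v) = (\<Sum>v\<in>{0,1}. \<delta> v)"
    by (rule sum.mono_neutral_right) (use n in \<open>auto simp: \<delta>_def\<close>)
  then have "(\<Sum>v<nv G. \<delta> v * 1) = 0" by (simp add: \<delta>_def)
  moreover have "\<exists>v<nv G. \<delta> v \<noteq> 0" using n by (intro exI[of _ 0]) (simp add: \<delta>_def)
  ultimately have \<delta>: "\<delta> \<in> ?A" by blast
  show ?thesis
  proof
    assume le: "second_eigenvalue G \<le> l"
    have q: "?q \<alpha> \<le> l" if "\<alpha> \<in> ?A" for \<alpha>
      using cSUP_upper[OF that bdd] le eq by simp
    show "expands G l"
      unfolding expands_def
    proof (intro conjI allI impI)
      \<comment> \<open>The sign of \<open>l\<close> follows from the quotient at
        \<open>\<delta>\<close>, a ratio of norms.\<close>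
      show "0 \<le> l" using q[OF \<delta>] by (rule order_trans[rotated]) (simp add: L2_set_nonneg)
      fix \<alpha> :: "nat \<Rightarrow> real" assume 0: "(\<Sum>v<nv G. \<alpha> v) = 0"
      show "L2_set (walk G \<alpha>) {..<nv G} \<le> l * L2_set \<alpha> {..<nv G}"
      proof (cases "\<exists>v<nv G. \<alpha> v \<noteq> 0")
        case True
        then show ?thesis using q[of \<alpha>] 0 pos[OF True] by (simp add: divide_le_eq)
      next
        case False
        then have "L2_set \<alpha> {..<nv G} = 0" by (simp add: L2_set_eq_0_iff)
        then show ?thesis using L2_walk_le[OF G, of \<alpha>] by simp
      qed
    qed
  next
    assume ex: "expands G l"
    show "second_eigenvalue G \<le> l"
      unfolding eq
    proof (rule cSUP_least)
      show "?A \<noteq> {}" using \<delta> by blast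
      fix \<alpha> assume "\<alpha> \<in> ?A"
      then show "?q \<alpha> \<le> l" using expandsD[OF ex, of \<alpha>] pos[of \<alpha>] by (simp add: divide_le_eq)
    qed
  qed
qed

lemma ndl_graph_iff:
  "ndl_graph N D l G \<longleftrightarrow> regular_graph G \<and> nv G = N \<and> deg G = D \<and> expands G l"
  using second_eigenvalue_le_iff by (auto simp: ndl_graph_def)

section \<open>Square, tensor product and zig-zag product\<close>

lemma enc_less: "a < m \<Longrightarrow> b < n \<Longrightarrow> enc n (a, b) < m * n"
  using mult_le_mono1[of "Suc a" m n] by (simp add: enc_def)

lemma dec_enc [simp]: "b < n \<Longrightarrow> dec n (enc n (a, b)) = (a, b)"
  by (simp add: enc_def dec_def)

lemma enc_dec [simp]: "enc n (dec n x) = x"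
  by (simp add: enc_def dec_def)

lemma dec_less:
  assumes "x < m * n"
  shows "fst (dec n x) < m" "snd (dec n x) < n"
proof -
  have "n > 0" using assms by (cases n) auto
  then show "fst (dec n x) < m" "snd (dec n x) < n"
    using assms by (simp_all add: dec_def less_mult_imp_div_less)
qed

lemma sum_enc: "(\<Sum>x<m * n. f x) = (\<Sum>a<m. \<Sum>b<n. f (enc n (a, b)))"
proof -
  have "(\<Sum>x<m * n. f x) = (\<Sum>a<m. sum f {a * n..<a * n + n})"
    by (rule sum.nat_group[symmetric])
  moreover have "sum f {a * n..<a * n + n} = (\<Sum>b<n. f (enc n (a, b)))" for a
    using sum.shift_bounds_nat_ivl[of f 0 "a * n" n]
    by (simp add: enc_def atLeast0LessThan add.commute)
  ultimately show ?thesis by simp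
qed

lemma square_sel [simp]:
  "nv (square G) = nv G" "deg (square G) = deg G ^ 2"
  "rot (square G) (v, k) =
     (let (k1, k2) = dec (deg G) k; (v1, l1) = rot G (v, k1); (v2, l2) = rot G (v1, k2)
      in (v2, enc (deg G) (l2, l1)))"
  by (simp_all add: square_def)

lemma tensor_sel [simp]:
  "nv (tensor G1 G2) = nv G1 * nv G2" "deg (tensor G1 G2) = deg G1 * deg G2"
  "rot (tensor G1 G2) (x, k) =
     (let (v, w) = dec (nv G2) x; (i, j) = dec (deg G2) k;
          (v', i') = rot G1 (v, i); (w', j') = rot G2 (w, j)
      in (enc (nv G2) (v', w'), enc (deg G2) (i', j')))"
  by (simp_all add: tensor_def)

lemma zigzag_sel [simp]:
  "nv (zigzag G1 G2) = nv G1 * deg G1" "deg (zigzag G1 G2) = deg G2 ^ 2"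
  "rot (zigzag G1 G2) (x, e) =
     (let (v, k) = dec (deg G1) x; (i, j) = dec (deg G2) e;
          (k', i') = rot G2 (k, i); (w, l') = rot G1 (v, k'); (l, j') = rot G2 (l', j)
      in (enc (deg G1) (w, l), enc (deg G2) (j', i')))"
  by (simp_all add: zigzag_def)

section \<open>Rotation maps of the products are involutions\<close>

lemma regular_graphI:
  assumes "nv G \<ge> 1" "deg G \<ge> 1"
    and "\<And>v i. v < nv G \<Longrightarrow> i < deg G \<Longrightarrow>
      fst (rot G (v, i)) < nv G \<and> snd (rot G (v, i)) < deg G \<and> rot G (rot G (v, i)) = (v, i)"
  shows "regular_graph G"
  using assms unfolding regular_graph_def rdom_def by (auto simp: mem_Times_iff)

lemma rotE:
  assumes "regular_graph G" "v < nv G" "i < deg G"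
  obtains w j where "rot G (v, i) = (w, j)" "w < nv G" "j < deg G" "rot G (w, j) = (v, i)"
proof -
  have "rot G (rot G (v, i)) = (v, i)"
    using assms by (auto simp: regular_graph_def rdom_def)
  with rot_in_rdom[OF assms] that show thesis
    by (cases "rot G (v, i)") auto
qed

lemma decE:
  assumes "x < m * n"
  obtains a b where "x = enc n (a, b)" "a < m" "b < n"
  using dec_less[OF assms] enc_dec[of n x] that by (metis prod.collapse)

text \<open>Walking back retraces the two edges in the opposite order, which is what the reversed
  output label \<open>(l2, l1)\<close> prescribes.\<close>

lemma regular_square:
  assumes G: "regular_graph G"
  shows "regular_graph (square G)"
proof (rule regular_graphI)
  show "nv (square G) \<ge> 1" "deg (square G) \<ge> 1"
    using G by (simp_all add: regular_graph_def)
  fix v k assume "v < nv (square G)" "k < deg (square G)"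
  then have v: "v < nv G" and k: "k < deg G * deg G" by (simp_all add: power2_eq_square)
  from k obtain k1 k2 where k: "k = enc (deg G) (k1, k2)" "k1 < deg G" "k2 < deg G" by (rule decE)
  obtain v1 l1 where 1: "rot G (v, k1) = (v1, l1)" "v1 < nv G" "l1 < deg G" "rot G (v1, l1) = (v, k1)"
    by (rule rotE[OF G v k(2)])
  obtain v2 l2 where 2: "rot G (v1, k2) = (v2, l2)" "v2 < nv G" "l2 < deg G" "rot G (v2, l2) = (v1, k2)"
    by (rule rotE[OF G 1(2) k(3)])
  show "fst (rot (square G) (v, k)) < nv (square G) \<and> snd (rot (square G) (v, k)) < deg (square G) \<and>
      rot (square G) (rot (square G) (v, k)) = (v, k)"
    using k 1 2 enc_less[OF 2(3) 1(3)] by (simp add: power2_eq_square)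
qed

lemma regular_tensor:
  assumes G: "regular_graph G1" and H: "regular_graph G2"
  shows "regular_graph (tensor G1 G2)"
proof (rule regular_graphI)
  show "nv (tensor G1 G2) \<ge> 1" "deg (tensor G1 G2) \<ge> 1"
    using G H by (simp_all add: regular_graph_def)
  fix x k assume "x < nv (tensor G1 G2)" "k < deg (tensor G1 G2)"
  then have x: "x < nv G1 * nv G2" and k: "k < deg G1 * deg G2" by simp_all
  from x obtain v w where x: "x = enc (nv G2) (v, w)" "v < nv G1" "w < nv G2" by (rule decE)
  from k obtain i j where k: "k = enc (deg G2) (i, j)" "i < deg G1" "j < deg G2" by (rule decE)
  obtain v' i' where 1: "rot G1 (v, i) = (v', i')" "v' < nv G1" "i' < deg G1" "rot G1 (v', i') = (v, i)"
    by (rule rotE[OF G x(2) k(2)])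
  obtain w' j' where 2: "rot G2 (w, j) = (w', j')" "w' < nv G2" "j' < deg G2" "rot G2 (w', j') = (w, j)"
    by (rule rotE[OF H x(3) k(3)])
  show "fst (rot (tensor G1 G2) (x, k)) < nv (tensor G1 G2) \<and>
      snd (rot (tensor G1 G2) (x, k)) < deg (tensor G1 G2) \<and>
      rot (tensor G1 G2) (rot (tensor G1 G2) (x, k)) = (x, k)"
    using x k 1 2 enc_less[OF 1(2) 2(2)] enc_less[OF 1(3) 2(3)] by simp
qed

lemma regular_zigzag:
  assumes G: "regular_graph G1" and H: "regular_graph G2" and d: "nv G2 = deg G1"
  shows "regular_graph (zigzag G1 G2)"
proof (rule regular_graphI)
  show "nv (zigzag G1 G2) \<ge> 1" "deg (zigzag G1 G2) \<ge> 1"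
    using G H by (simp_all add: regular_graph_def)
  fix x e assume "x < nv (zigzag G1 G2)" "e < deg (zigzag G1 G2)"
  then have x: "x < nv G1 * nv G2" and e: "e < deg G2 * deg G2" using d by (simp_all add: power2_eq_square)
  from x obtain v k where x: "x = enc (nv G2) (v, k)" "v < nv G1" "k < nv G2" by (rule decE)
  from e obtain i j where e: "e = enc (deg G2) (i, j)" "i < deg G2" "j < deg G2" by (rule decE)
  obtain k' i' where 1: "rot G2 (k, i) = (k', i')" "k' < nv G2" "i' < deg G2" "rot G2 (k', i') = (k, i)"
    by (rule rotE[OF H x(3) e(2)])
  have k': "k' < deg G1" using 1 d by simp
  obtain w l' where 2: "rot G1 (v, k') = (w, l')" "w < nv G1" "l' < deg G1" "rot G1 (w, l') = (v, k')"
    by (rule rotE[OF G x(2) k'])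
  have l': "l' < nv G2" using 2 d by simp
  obtain l j' where 3: "rot G2 (l', j) = (l, j')" "l < nv G2" "j' < deg G2" "rot G2 (l, j') = (l', j)"
    by (rule rotE[OF H l' e(3)])
  show "fst (rot (zigzag G1 G2) (x, e)) < nv (zigzag G1 G2) \<and>
      snd (rot (zigzag G1 G2) (x, e)) < deg (zigzag G1 G2) \<and>
      rot (zigzag G1 G2) (rot (zigzag G1 G2) (x, e)) = (x, e)"
    using x e 1 2 3 d enc_less[OF 2(2) 3(2)] enc_less[OF 3(3) 1(3)] by (simp add: power2_eq_square)
qed

section \<open>Walk operators and expansion of the products\<close>

lemma walk_square: "walk (square G) \<alpha> u = walk G (walk G \<alpha>) u"
  by (simp add: walk_def power2_eq_square sum_enc split_beta Let_def sum_divide_distrib)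

lemma walk_tensor:
  assumes "w < nv G2"
  shows "walk (tensor G1 G2) \<alpha> (enc (nv G2) (u, w))
    = walk G1 (\<lambda>u'. walk G2 (\<lambda>w'. \<alpha> (enc (nv G2) (u', w'))) w) u"
  using assms by (simp add: walk_def sum_enc split_beta Let_def sum_divide_distrib mult.commute)

text \<open>The factorisation B A B: the inner walk averages over the label \<open>j\<close>, the
  \<open>case\<close> is the edge permutation A, and the outer walk averages over
  \<open>i\<close>.\<close>

lemma walk_zigzag:
  assumes "k < deg G1"
  shows "walk (zigzag G1 G2) \<alpha> (enc (deg G1) (v, k))
    = walk G2 (\<lambda>k'. case rot G1 (v, k') of (w, l') \<Rightarrow> walk G2 (\<lambda>l. \<alpha> (enc (deg G1) (w, l))) l') k"
  using assms by (simp add: walk_def power2_eq_square sum_enc split_beta Let_def sum_divide_distrib)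

text \<open>The walk preserves the sum of a vector, hence zero sums, so the bound applies a second
  time to the image.\<close>

lemma expands_square:
  assumes G: "regular_graph G" and ex: "expands G l"
  shows "expands (square G) (l\<^sup>2)"
  unfolding expands_def
proof (intro conjI allI impI)
  show "0 \<le> l\<^sup>2" by simp
  fix \<alpha> :: "nat \<Rightarrow> real" assume "(\<Sum>v<nv (square G). \<alpha> v) = 0"
  then have 0: "(\<Sum>v<nv G. \<alpha> v) = 0" by simp
  have "L2_set (walk G (walk G \<alpha>)) {..<nv G} \<le> l * L2_set (walk G \<alpha>) {..<nv G}"
    by (rule expandsD[OF ex]) (simp add: sum_walk[OF G] 0)
  also have "\<dots> \<le> l * (l * L2_set \<alpha> {..<nv G})"
    using ex by (intro mult_left_mono expandsD[OF ex 0]) (simp add: expands_def)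
  finally show "L2_set (walk (square G) \<alpha>) {..<nv (square G)} \<le> l\<^sup>2 * L2_set \<alpha> {..<nv (square G)}"
    by (simp add: walk_square[abs_def] power2_eq_square mult.assoc)
qed

lemma L2_le_mult_iff:
  assumes "0 \<le> c"
  shows "L2_set f A \<le> c * L2_set g B \<longleftrightarrow> (\<Sum>x\<in>A. (f x)\<^sup>2) \<le> c\<^sup>2 * (\<Sum>x\<in>B. (g x)\<^sup>2)"
proof -
  have "c * L2_set g B = sqrt (c\<^sup>2 * (\<Sum>x\<in>B. (g x)\<^sup>2))"
    using assms by (simp add: L2_set_def real_sqrt_mult)
  then show ?thesis by (simp add: L2_set_def)
qed

text \<open>Pythagoras: a vector constant on each block is orthogonal to one with zero sum on each
  block, so the cross terms vanish.\<close>

lemma sum_square_split: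
  fixes a :: "nat \<Rightarrow> real"
  assumes "\<And>v. v < m \<Longrightarrow> (\<Sum>w<n. g v w) = 0"
  shows "(\<Sum>v<m. \<Sum>w<n. (a v + g v w)\<^sup>2)
    = real n * (\<Sum>v<m. (a v)\<^sup>2) + (\<Sum>v<m. \<Sum>w<n. (g v w)\<^sup>2)"
proof -
  have "(\<Sum>w<n. (a v + g v w)\<^sup>2) = real n * (a v)\<^sup>2 + (\<Sum>w<n. (g v w)\<^sup>2)" if "v < m" for v
    using assms[OF that]
    by (simp add: power2_sum sum.distrib sum_distrib_left[symmetric] mult.assoc)
  then show ?thesis by (simp add: sum.distrib sum_distrib_left)
qed

definition fmean :: "nat \<Rightarrow> (nat \<Rightarrow> nat \<Rightarrow> real) \<Rightarrow> nat \<Rightarrow> real" where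
  "fmean n f v = (\<Sum>w<n. f v w) / real n"

definition frest :: "nat \<Rightarrow> (nat \<Rightarrow> nat \<Rightarrow> real) \<Rightarrow> nat \<Rightarrow> nat \<Rightarrow> real" where
  "frest n f v w = f v w - fmean n f v"

lemma fmean_frest: "f v w = fmean n f v + frest n f v w"
  by (simp add: frest_def)

lemma sum_frest: "n > 0 \<Longrightarrow> (\<Sum>w<n. frest n f v w) = 0"
  by (simp add: frest_def fmean_def sum_subtractf)

lemma sum_square_fmean_frest:
  assumes "n > 0"
  shows "(\<Sum>v<m. \<Sum>w<n. (f v w)\<^sup>2)
    = real n * (\<Sum>v<m. (fmean n f v)\<^sup>2) + (\<Sum>v<m. \<Sum>w<n. (frest n f v w)\<^sup>2)"
  using sum_square_split[where g = "frest n f" and a = "fmean n f" and m = m, OF sum_frest[OF assms]]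
  by (simp add: fmean_frest[symmetric])

lemma sum_fmean: "(\<Sum>v<m. fmean n f v) = (\<Sum>v<m. \<Sum>w<n. f v w) / real n"
  by (simp add: fmean_def sum_divide_distrib)

lemma walk_fmean_frest:
  assumes "regular_graph G"
  shows "walk G (f v) w = fmean n f v + walk G (frest n f v) w"
proof -
  have "walk G (f v) w = walk G (\<lambda>w. fmean n f v + frest n f v w) w"
    by (simp add: fmean_frest[symmetric])
  then show ?thesis by (simp add: walk_add walk_const[OF assms])
qed

lemma expands_square_sum:
  assumes "expands G l" "(\<Sum>v<nv G. \<alpha> v) = 0"
  shows "(\<Sum>u<nv G. (walk G \<alpha> u)\<^sup>2) \<le> l\<^sup>2 * (\<Sum>u<nv G. (\<alpha> u)\<^sup>2)"
  using L2_le_mult_iff[THEN iffD1, OF _ expandsD[OF assms]] assms(1) by (simp add: expands_def)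

lemma walk_square_sum_le:
  assumes "regular_graph G"
  shows "(\<Sum>u<nv G. (walk G \<alpha> u)\<^sup>2) \<le> (\<Sum>u<nv G. (\<alpha> u)\<^sup>2)"
  using L2_walk_le[OF assms, of \<alpha>] by (simp add: L2_set_le_iff)

lemma walk_sum: "walk G (\<lambda>u. \<Sum>w\<in>S. f u w) v = (\<Sum>w\<in>S. walk G (\<lambda>u. f u w) v)"
  unfolding walk_def sum_divide_distrib by (rule sum.swap)

lemma walk_zero: "walk G (\<lambda>_. 0) u = 0"
  by (simp add: walk_def)

text \<open>Walk in the second factor first. It fixes the row means, which \<open>G1\<close> then
  contracts because their sum is zero; it contracts the rests, which \<open>G1\<close> does not
  enlarge. The two images are again orthogonal, because \<open>G1\<close> acts column by column and
  so keeps the row sums of the rests zero.\<close>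

lemma expands_tensor:
  assumes G1: "regular_graph G1" and G2: "regular_graph G2"
    and ex1: "expands G1 l" and ex2: "expands G2 l"
  shows "expands (tensor G1 G2) l"
  unfolding expands_def
proof (intro conjI allI impI)
  show l: "0 \<le> l" using ex1 by (simp add: expands_def)
  let ?m = "nv G1" and ?n = "nv G2"
  have n: "?n > 0" using G2 by (simp add: regular_graph_def)
  fix \<alpha> :: "nat \<Rightarrow> real" assume 0: "(\<Sum>x<nv (tensor G1 G2). \<alpha> x) = 0"
  define f where "f = (\<lambda>v w. \<alpha> (enc ?n (v, w)))"
  define q where "q = (\<lambda>u w. walk G2 (frest ?n f u) w)"
  have "(\<Sum>v<?m. fmean ?n f v) = 0" using 0 by (simp add: sum_fmean sum_enc f_def)
  note mean = expands_square_sum[OF ex1 this]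
  have R: "walk (tensor G1 G2) \<alpha> (enc ?n (u, w))
      = walk G1 (fmean ?n f) u + walk G1 (\<lambda>u. q u w) u" if "w < ?n" for u w
    unfolding walk_tensor[OF that] q_def walk_add[symmetric]
    by (simp add: walk_fmean_frest[OF G2, symmetric] f_def)
  have "(\<Sum>w<?n. q u w) = 0" for u
    unfolding q_def using sum_walk[OF G2] sum_frest[OF n] by simp
  then have q0: "(\<Sum>w<?n. walk G1 (\<lambda>u. q u w) v) = 0" for v
    by (simp add: walk_sum[symmetric] walk_zero)
  have "(\<Sum>u<?m. \<Sum>w<?n. (walk G1 (\<lambda>u. q u w) u)\<^sup>2) = (\<Sum>w<?n. \<Sum>u<?m. (walk G1 (\<lambda>u. q u w) u)\<^sup>2)"
    by (rule sum.swap)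
  also have "\<dots> \<le> (\<Sum>w<?n. \<Sum>u<?m. (q u w)\<^sup>2)"
    by (intro sum_mono walk_square_sum_le[OF G1])
  also have "\<dots> = (\<Sum>u<?m. \<Sum>w<?n. (q u w)\<^sup>2)"
    by (rule sum.swap)
  also have "\<dots> \<le> (\<Sum>u<?m. l\<^sup>2 * (\<Sum>w<?n. (frest ?n f u w)\<^sup>2))"
    unfolding q_def by (intro sum_mono expands_square_sum[OF ex2] sum_frest n)
  finally have rest: "(\<Sum>u<?m. \<Sum>w<?n. (walk G1 (\<lambda>u. q u w) u)\<^sup>2)
      \<le> l\<^sup>2 * (\<Sum>u<?m. \<Sum>w<?n. (frest ?n f u w)\<^sup>2)"
    by (simp add: sum_distrib_left)
  have "(\<Sum>x<?m * ?n. (walk (tensor G1 G2) \<alpha> x)\<^sup>2)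
      = (\<Sum>u<?m. \<Sum>w<?n. (walk G1 (fmean ?n f) u + walk G1 (\<lambda>u. q u w) u)\<^sup>2)"
    by (simp add: sum_enc R)
  also have "\<dots> = real ?n * (\<Sum>u<?m. (walk G1 (fmean ?n f) u)\<^sup>2) + (\<Sum>u<?m. \<Sum>w<?n. (walk G1 (\<lambda>u. q u w) u)\<^sup>2)"
    by (rule sum_square_split[OF q0])
  also have "\<dots> \<le> real ?n * (l\<^sup>2 * (\<Sum>u<?m. (fmean ?n f u)\<^sup>2)) + l\<^sup>2 * (\<Sum>u<?m. \<Sum>w<?n. (frest ?n f u w)\<^sup>2)"
    by (intro add_mono mult_left_mono mean rest) simp
  also have "\<dots> = l\<^sup>2 * (\<Sum>u<?m. \<Sum>w<?n. (f u w)\<^sup>2)"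
    unfolding sum_square_fmean_frest[OF n, of f] by (simp add: algebra_simps)
  also have "(\<Sum>u<?m. \<Sum>w<?n. (f u w)\<^sup>2) = (\<Sum>x<?m * ?n. (\<alpha> x)\<^sup>2)"
    by (simp add: sum_enc f_def)
  finally show "L2_set (walk (tensor G1 G2) \<alpha>) {..<nv (tensor G1 G2)} \<le> l * L2_set \<alpha> {..<nv (tensor G1 G2)}"
    using l by (simp add: L2_le_mult_iff)
qed


lemma sum_rdom: "(\<Sum>x\<in>rdom G. f x) = (\<Sum>v<nv G. \<Sum>i<deg G. f (v, i))"
  unfolding rdom_def by (rule sum.cartesian_product')

lemma L2_rot:
  assumes "regular_graph G"
  shows "L2_set (\<lambda>x. f (rot G x)) (rdom G) = L2_set f (rdom G)"
  unfolding L2_set_def by (subst sum_rot[OF assms, of "\<lambda>x. (f x)\<^sup>2"]) simp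

text \<open>
  This bounds \<open>\<langle>A B f, B g\<rangle>\<close>, which falls into four terms when \<open>f\<close> and \<open>g\<close> are split into cloud
  means and rests.
\<close>

lemma zigzag_form_le:
  assumes G: "regular_graph G1" and H: "regular_graph G2" and d: "nv G2 = deg G1"
    and ex1: "expands G1 l1" and ex2: "expands G2 l2"
    and 0: "(\<Sum>v<nv G1. \<Sum>k<deg G1. f v k) = 0"
  shows "(\<Sum>x\<in>rdom G1. (case rot G1 x of (w, l) \<Rightarrow> walk G2 (f w) l) * (case x of (v, k) \<Rightarrow> walk G2 (g v) k))
    \<le> (l1 + l2 + l2\<^sup>2) * (L2_set (case_prod f) (rdom G1) * L2_set (case_prod g) (rdom G1))"
proof -
  let ?S = "rdom G1" and ?n = "deg G1"
  let ?N = "\<lambda>h. L2_set h (rdom G1)"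
  have n: "?n > 0" using G by (simp add: regular_graph_def)
  have l: "0 \<le> l1" "0 \<le> l2" using ex1 ex2 by (simp_all add: expands_def)
  define m where "m = (\<lambda>f (x :: nat \<times> nat). fmean ?n f (fst x))"
  define r where "r = (\<lambda>f (x :: nat \<times> nat). walk G2 (frest ?n f (fst x)) (snd x))"
  define e where "e = (\<lambda>f (x :: nat \<times> nat). frest ?n f (fst x) (snd x))"
  have walk_split: "(case x of (v, k) \<Rightarrow> walk G2 (h v) k) = m h x + r h x" for x h
    by (simp add: m_def r_def split_beta walk_fmean_frest[OF H, symmetric])
  have norm_split: "(?N (case_prod h))\<^sup>2 = (?N (m h))\<^sup>2 + (?N (e h))\<^sup>2" for h
    by (simp add: L2_set_sq sum_rdom m_def e_def sum_square_fmean_frest[OF n, of h]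
        sum_distrib_left)
  have r_le: "?N (r h) \<le> l2 * ?N (e h)" for h
  proof -
    have "(\<Sum>v<nv G1. \<Sum>k<?n. (r h (v, k))\<^sup>2) \<le> (\<Sum>v<nv G1. l2\<^sup>2 * (\<Sum>k<?n. (e h (v, k))\<^sup>2))"
    proof (rule sum_mono)
      fix v
      show "(\<Sum>k<?n. (r h (v, k))\<^sup>2) \<le> l2\<^sup>2 * (\<Sum>k<?n. (e h (v, k))\<^sup>2)"
        using expands_square_sum[OF ex2, of "frest ?n h v"] sum_frest[OF n, of h v] d
        by (simp add: r_def e_def)
    qed
    then show ?thesis using l(2) by (simp add: L2_le_mult_iff sum_rdom sum_distrib_left)
  qed
  \<comment> \<open>A mean ignores the position in the cloud, so between means the edge permutation
    acts as the walk on \<open>G1\<close>, up to the common factor \<open>deg G1\<close>.\<close>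
  have m_fst: "(\<Sum>x\<in>?S. m f (rot G1 x) * m g x) \<le> l1 * (?N (m f) * ?N (m g))"
  proof -
    let ?a = "fmean ?n f" and ?b = "fmean ?n g"
    let ?L = "\<lambda>h. L2_set h {..<nv G1}"
    have a0: "(\<Sum>v<nv G1. ?a v) = 0" using 0 by (simp add: sum_fmean)
    have lift: "?N (m h) = sqrt ?n * ?L (fmean ?n h)" for h
      by (simp add: L2_set_def sum_rdom m_def sum_distrib_left[symmetric] real_sqrt_mult)
    have "(\<Sum>x\<in>?S. m f (rot G1 x) * m g x) = real ?n * (\<Sum>v<nv G1. ?b v * walk G1 ?a v)"
      using n by (simp add: sum_mult_walk[OF G] m_def mult.commute)
    also have "\<dots> \<le> real ?n * (?L ?b * ?L (walk G1 ?a))"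
      by (intro mult_left_mono sum_mult_le_L2) simp
    also have "\<dots> \<le> real ?n * (?L ?b * (l1 * ?L ?a))"
      by (intro mult_left_mono expandsD[OF ex1 a0]) simp_all
    also have "\<dots> = (sqrt ?n * sqrt ?n) * (?L ?b * (l1 * ?L ?a))" by simp
    also have "\<dots> = l1 * (?N (m f) * ?N (m g))" unfolding lift by (simp only: mult_ac)
    finally show ?thesis .
  qed
  define A B C D where "A = ?N (m f)" and "B = ?N (e f)" and "C = ?N (m g)" and "D = ?N (e g)"
  have nn: "0 \<le> A" "0 \<le> B" "0 \<le> C" "0 \<le> D" by (simp_all add: A_def B_def C_def D_def)
  have cross: "(\<Sum>x\<in>?S. p (rot G1 x) * q x) \<le> ?N p * ?N q" for p q :: "nat \<times> nat \<Rightarrow> real"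
    using sum_mult_le_L2[of "\<lambda>x. p (rot G1 x)" q ?S] by (simp add: L2_rot[OF G])
  have 2: "(\<Sum>x\<in>?S. m f (rot G1 x) * r g x) \<le> A * (l2 * D)"
    unfolding A_def D_def by (rule order_trans[OF cross]) (intro mult_left_mono r_le, simp)
  have 3: "(\<Sum>x\<in>?S. r f (rot G1 x) * m g x) \<le> l2 * B * C"
    unfolding B_def C_def by (rule order_trans[OF cross]) (intro mult_right_mono r_le, simp)
  have 4: "(\<Sum>x\<in>?S. r f (rot G1 x) * r g x) \<le> (l2 * B) * (l2 * D)"
    unfolding B_def D_def by (rule order_trans[OF cross]) (intro mult_mono r_le, simp_all add: l)
  have "(\<Sum>x\<in>?S. (case rot G1 x of (w, l) \<Rightarrow> walk G2 (f w) l) * (case x of (v, k) \<Rightarrow> walk G2 (g v) k))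
      = (\<Sum>x\<in>?S. m f (rot G1 x) * m g x) + (\<Sum>x\<in>?S. m f (rot G1 x) * r g x)
        + (\<Sum>x\<in>?S. r f (rot G1 x) * m g x) + (\<Sum>x\<in>?S. r f (rot G1 x) * r g x)"
    unfolding walk_split by (simp add: algebra_simps sum.distrib)
  also have "\<dots> \<le> l1 * (A * C) + A * (l2 * D) + l2 * B * C + (l2 * B) * (l2 * D)"
    using m_fst 2 3 4 by (simp add: A_def C_def)
  also have "\<dots> = l1 * (A * C) + l2 * (A * D + B * C) + l2\<^sup>2 * (B * D)"
    by (simp add: algebra_simps power2_eq_square)
  \<comment> \<open>Each of A C, B D and A D + B C is at most the product of the norms of (A, B) and
    (C, D). For the third this is Cauchy-Schwarz, whose defect is the square of A C - B D.\<close>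
  also have "\<dots> \<le> (l1 + l2 + l2\<^sup>2) * (sqrt (A\<^sup>2 + B\<^sup>2) * sqrt (C\<^sup>2 + D\<^sup>2))"
  proof -
    have "A * C \<le> sqrt (A\<^sup>2 + B\<^sup>2) * sqrt (C\<^sup>2 + D\<^sup>2)" "B * D \<le> sqrt (A\<^sup>2 + B\<^sup>2) * sqrt (C\<^sup>2 + D\<^sup>2)"
      by (intro mult_mono nn real_le_rsqrt real_sqrt_ge_zero add_nonneg_nonneg zero_le_power2; simp)+
    moreover have "A * D + B * C \<le> sqrt (A\<^sup>2 + B\<^sup>2) * sqrt (C\<^sup>2 + D\<^sup>2)"
      unfolding real_sqrt_mult[symmetric]
    proof (rule real_le_rsqrt)
      show "(A * D + B * C)\<^sup>2 \<le> (A\<^sup>2 + B\<^sup>2) * (C\<^sup>2 + D\<^sup>2)"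
        using zero_le_power2[of "A * C - B * D"] by (simp add: power2_eq_square algebra_simps)
    qed
    ultimately show ?thesis using l unfolding distrib_right
      by (intro add_mono mult_left_mono) simp_all
  qed
  also have "sqrt (A\<^sup>2 + B\<^sup>2) = ?N (case_prod f)"
    unfolding A_def B_def norm_split[symmetric] by simp
  also have "sqrt (C\<^sup>2 + D\<^sup>2) = ?N (case_prod g)"
    unfolding C_def D_def norm_split[symmetric] by simp
  finally show ?thesis .
qed

text \<open>The image \<open>g\<close> is tested against itself: by symmetry of the cloud walk one
  factor B moves to the other side, and \<open>zigzag_form_le\<close> bounds the squared norm of the
  image by a multiple of its norm times that of \<open>\<alpha>\<close>. One norm of the image then
  cancels.\<close>

lemma expands_zigzag:
  assumes G: "regular_graph G1" and H: "regular_graph G2" and d: "nv G2 = deg G1"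
    and ex1: "expands G1 l1" and ex2: "expands G2 l2"
  shows "expands (zigzag G1 G2) (l1 + l2 + l2\<^sup>2)"
  unfolding expands_def
proof (intro conjI allI impI)
  let ?Z = "zigzag G1 G2" and ?l = "l1 + l2 + l2\<^sup>2"
  show "0 \<le> ?l" using ex1 ex2 by (simp add: expands_def)
  fix \<alpha> :: "nat \<Rightarrow> real" assume 0: "(\<Sum>x<nv ?Z. \<alpha> x) = 0"
  define f where "f = (\<lambda>v k. \<alpha> (enc (deg G1) (v, k)))"
  define g where "g = (\<lambda>v k. walk ?Z \<alpha> (enc (deg G1) (v, k)))"
  define h where "h = (\<lambda>x. case rot G1 x of (w, l) \<Rightarrow> walk G2 (f w) l)"
  have L2: "L2_set (case_prod (\<lambda>v k. \<beta> (enc (deg G1) (v, k)))) (rdom G1) = L2_set \<beta> {..<nv ?Z}" for \<beta>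
    by (simp add: L2_set_def sum_rdom sum_enc)
  have g: "g v k = walk G2 (\<lambda>k'. h (v, k')) k" if "k < deg G1" for v k
    unfolding g_def h_def f_def by (simp add: walk_zigzag[OF that])
  have "(L2_set (walk ?Z \<alpha>) {..<nv ?Z})\<^sup>2 = (\<Sum>v<nv G1. \<Sum>k<nv G2. g v k * g v k)"
    unfolding L2_set_sq by (simp add: sum_enc g_def d power2_eq_square)
  also have "\<dots> = (\<Sum>v<nv G1. \<Sum>k<nv G2. g v k * walk G2 (\<lambda>k'. h (v, k')) k)"
    using g d by (intro sum.cong refl) simp
  also have "\<dots> = (\<Sum>v<nv G1. \<Sum>k<nv G2. walk G2 (g v) k * h (v, k))"
    unfolding walk_symmetric[OF H] ..
  also have "\<dots> = (\<Sum>x\<in>rdom G1. h x * (case x of (v, k) \<Rightarrow> walk G2 (g v) k))"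
    by (simp add: sum_rdom d mult.commute)
  also have "\<dots> \<le> ?l * (L2_set (case_prod f) (rdom G1) * L2_set (case_prod g) (rdom G1))"
    unfolding h_def by (rule zigzag_form_le[OF G H d ex1 ex2]) (use 0 in \<open>simp add: sum_enc f_def\<close>)
  also have "\<dots> = ?l * L2_set \<alpha> {..<nv ?Z} * L2_set (walk ?Z \<alpha>) {..<nv ?Z}"
    unfolding f_def g_def L2 by simp
  finally have "L2_set (walk ?Z \<alpha>) {..<nv ?Z} * L2_set (walk ?Z \<alpha>) {..<nv ?Z}
      \<le> ?l * L2_set \<alpha> {..<nv ?Z} * L2_set (walk ?Z \<alpha>) {..<nv ?Z}"
    by (simp add: power2_eq_square)
  moreover have "0 \<le> ?l * L2_set \<alpha> {..<nv ?Z}"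
    using \<open>0 \<le> ?l\<close> by simp
  ultimately show "L2_set (walk ?Z \<alpha>) {..<nv ?Z} \<le> ?l * L2_set \<alpha> {..<nv ?Z}"
    by (metis L2_set_nonneg mult_right_le_imp_le order_le_less)
qed

section \<open>The sequence of graphs\<close>

lemma graph_seq_1: "graph_seq H (Suc 0) = square H"
  by (simp add: graph_seq.simps)

lemma graph_seq_2: "graph_seq H 2 = tensor H H"
  by (simp add: graph_seq.simps)

text \<open>The real roundings become the divisions of natural numbers that the machine
  computes.\<close>

lemma graph_seq_ge_3:
  assumes "3 \<le> t"
  shows "graph_seq H t
    = zigzag (square (tensor (graph_seq H (t div 2)) (graph_seq H ((t - 1) div 2)))) H"
proof -
  have "nat \<lceil>(real t - 1) / 2\<rceil> = t div 2 \<and> nat \<lfloor>(real t - 1) / 2\<rfloor> = (t - 1) div 2"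
  proof (cases "even t")
    case True
    then obtain k where k: "t = 2 * k" by blast
    have "\<lceil>(real t - 1) / 2\<rceil> = int k"
      unfolding ceiling_eq_iff using k by (simp add: field_simps)
    moreover have "\<lfloor>(real t - 1) / 2\<rfloor> = int k - 1"
      unfolding floor_eq_iff using k by (simp add: field_simps)
    ultimately show ?thesis using k assms by (simp add: nat_diff_distrib)
  next
    case False
    then obtain k where "t = 2 * k + 1" by (rule oddE)
    then show ?thesis by simp
  qed
  then show ?thesis
    using assms by (subst graph_seq.simps) simp
qed

text \<open>The summand 1 is the digit of the cloud; it makes the exponents in the vertex counts add
  up to \<open>8 * t\<close>.\<close>

lemma halves_sum: "3 \<le> t \<Longrightarrow> t div 2 + (t - 1) div 2 + 1 = (t :: nat)"
proof (cases "even t")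
  case True
  assume "3 \<le> t"
  with True show ?thesis by (auto elim!: evenE)
next
  case False
  then show ?thesis by (auto elim!: oddE)
qed

lemma graph_seq_induct [consumes 1, case_names 1 2 ge_3]:
  assumes "1 \<le> t" "P 1" "P 2"
    and "\<And>t. 3 \<le> t \<Longrightarrow> P (t div 2) \<Longrightarrow> P ((t - 1) div 2) \<Longrightarrow> P t"
  shows "P (t :: nat)"
  using assms(1)
proof (induction t rule: less_induct)
  case (less t)
  consider "t = 1" | "t = 2" | "3 \<le> t" using less.prems by linarith
  then show ?case
  proof cases
    case 3
    then show ?thesis by (rule assms(4); intro less.IH) auto
  qed (use assms in auto)
qed

text \<open>Here the exponent 8 originates: two factors of degree \<open>D\<^sup>2\<close> give
  degree \<open>(D\<^sup>2 * D\<^sup>2)\<^sup>2\<close> after squaring, which has to be the number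
  of vertices of \<open>H\<close>.\<close>

lemma graph_seq_large:
  assumes "regular_graph G1" "nv G1 = D ^ (8 * a)" "deg G1 = D\<^sup>2"
    and "regular_graph G2" "nv G2 = D ^ (8 * b)" "deg G2 = D\<^sup>2"
  shows "regular_graph (square (tensor G1 G2))" "nv (square (tensor G1 G2)) = D ^ (8 * (a + b))"
    "deg (square (tensor G1 G2)) = D ^ 8"
proof -
  show "regular_graph (square (tensor G1 G2))"
    using assms by (intro regular_square regular_tensor)
  show "nv (square (tensor G1 G2)) = D ^ (8 * (a + b))"
    using assms by (simp add: power_add distrib_left)
  have "(D\<^sup>2 * D\<^sup>2)\<^sup>2 = D ^ 8" by (simp flip: power_add power_mult)
  then show "deg (square (tensor G1 G2)) = D ^ 8" using assms by simp
qed

lemma graph_seq_regular: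
  assumes H: "regular_graph H" "nv H = D ^ 8" "deg H = D" and t: "1 \<le> t"
  shows "regular_graph (graph_seq H t) \<and> nv (graph_seq H t) = D ^ (8 * t) \<and> deg (graph_seq H t) = D\<^sup>2"
  using t
proof (induction t rule: graph_seq_induct)
  case 1
  then show ?case using H by (simp add: graph_seq_1 regular_square)
next
  case 2
  then show ?case using H by (simp add: graph_seq_2 regular_tensor power_add[symmetric] power2_eq_square)
next
  case (ge_3 t)
  let ?a = "t div 2" and ?b = "(t - 1) div 2"
  let ?G = "square (tensor (graph_seq H ?a) (graph_seq H ?b))"
  have G: "regular_graph ?G" "nv ?G = D ^ (8 * (?a + ?b))" "deg ?G = D ^ 8"
    using graph_seq_large[of "graph_seq H ?a" D ?a "graph_seq H ?b" ?b] ge_3 by blast+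
  have "D ^ (8 * (?a + ?b)) * D ^ 8 = D ^ (8 * (?a + ?b + 1))"
    by (simp add: power_add distrib_left)
  then have "nv (zigzag ?G H) = D ^ (8 * t)"
    using G by (simp only: zigzag_sel halves_sum[OF ge_3(1)])
  moreover have "regular_graph (zigzag ?G H)"
    by (rule regular_zigzag) (simp_all only: G H)
  ultimately show ?case
    using H by (simp only: graph_seq_ge_3[OF ge_3(1)] zigzag_sel)
qed

lemma graph_seq_expands:
  assumes H: "regular_graph H" "nv H = D ^ 8" "deg H = D" and ex: "expands H l"
    and l: "l \<le> 1 / 5" and t: "1 \<le> t"
  shows "expands (graph_seq H t) (l + 5 * l\<^sup>2)"
  using t
proof (induction t rule: graph_seq_induct)
  have l0: "0 \<le> l" using ex by (simp add: expands_def)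
  {
    case 1
    have "l\<^sup>2 \<le> l + 5 * l\<^sup>2" using l0 by simp
    then show ?case using expands_mono[OF expands_square[OF H(1) ex]] by (simp add: graph_seq_1)
  next
    case 2
    then show ?case
      using expands_mono[OF expands_tensor[OF H(1) H(1) ex ex]] by (simp add: graph_seq_2)
  next
    case (ge_3 t)
    let ?a = "graph_seq H (t div 2)" and ?b = "graph_seq H ((t - 1) div 2)"
    have reg: "regular_graph ?a" "regular_graph ?b"
      "regular_graph (square (tensor ?a ?b))" "deg (square (tensor ?a ?b)) = D ^ 8"
      using graph_seq_regular[OF H, of "t div 2"] graph_seq_regular[OF H, of "(t - 1) div 2"]
        graph_seq_large[of ?a D "t div 2" ?b "(t - 1) div 2"] ge_3(1) by auto
    have "expands (square (tensor ?a ?b)) ((l + 5 * l\<^sup>2)\<^sup>2)"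
      using reg ge_3 by (intro expands_square expands_tensor regular_tensor)
    then have "expands (zigzag (square (tensor ?a ?b)) H) ((l + 5 * l\<^sup>2)\<^sup>2 + l + l\<^sup>2)"
      by (intro expands_zigzag reg H ex) (simp only: H reg)
    \<comment> \<open>Subtracting \<open>l + l\<^sup>2\<close> leaves
      \<open>l\<^sup>2 * (1 + 5 * l)\<^sup>2 \<le> 4 * l\<^sup>2\<close>, which holds as soon as 1 +
      5 l \<le> 2; this fixes the threshold 1/5.\<close>
    moreover have "(l + 5 * l\<^sup>2)\<^sup>2 + l + l\<^sup>2 \<le> l + 5 * l\<^sup>2"
    proof -
      have "(1 + 5 * l)\<^sup>2 \<le> 2\<^sup>2" using l l0 by (intro power_mono) auto
      then have "l\<^sup>2 * (1 + 5 * l)\<^sup>2 \<le> l\<^sup>2 * 4" by (intro mult_left_mono) auto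
      also have "l\<^sup>2 * (1 + 5 * l)\<^sup>2 = (l + 5 * l\<^sup>2)\<^sup>2"
        by (simp add: power_mult_distrib[symmetric] algebra_simps power2_eq_square)
      finally show ?thesis by simp
    qed
    ultimately show ?case unfolding graph_seq_ge_3[OF ge_3(1)] by (rule expands_mono)
  }
qed

lemma graph_seq_ndl:
  assumes H: "ndl_graph (D ^ 8) D l H" and t: "1 \<le> t"
  shows "\<exists>l_t. l_t \<le> l + 20 * l\<^sup>2 \<and> ndl_graph (D ^ (8 * t)) (D\<^sup>2) l_t (graph_seq H t)"
proof -
  have reg: "regular_graph H" "nv H = D ^ 8" "deg H = D" and ex: "expands H l"
    using H by (simp_all add: ndl_graph_iff)
  note seq = graph_seq_regular[OF reg t]
  show ?thesis
  proof (cases "l \<le> 1 / 5")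
    case True
    then show ?thesis using graph_seq_expands[OF reg ex True t] seq
      by (intro exI[of _ "l + 5 * l\<^sup>2"]) (simp add: ndl_graph_iff)
  next
    case False
    \<comment> \<open>Beyond the threshold contraction alone suffices, and 20 is chosen so that 1/5
      + 20/25 = 1.\<close>
    then have "(1 / 5)\<^sup>2 \<le> l\<^sup>2" by (intro power_mono) auto
    then have "1 \<le> l + 20 * l\<^sup>2" using False by (simp add: power2_eq_square)
    then show ?thesis using seq by (intro exI[of _ 1]) (simp add: ndl_graph_iff expands_one)
  qed
qed

section \<open>Cost of loop-free programs and of loops\<close>

text \<open>A partial evaluator for loop-free programs. It leaves out the time, so that symbolic
  execution tracks only memory and queries; the time is bounded separately, uniformly for each
  program.\<close>

fun exec :: "(nat \<times> nat \<rightharpoonup> nat \<times> nat) \<Rightarrow> prog \<Rightarrow> mem \<Rightarrow> (nat \<times> mem) option" where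
  "exec orc Skip s = Some (0, s)"
| "exec orc (Store a e) s = Some (0, s(val s a := val s e))"
| "exec orc (Seq p p') s =
    (case exec orc p s of None \<Rightarrow> None | Some (q, s1) \<Rightarrow>
      (case exec orc p' s1 of None \<Rightarrow> None | Some (q', s2) \<Rightarrow> Some (q + q', s2)))"
| "exec orc (Cond e p p') s = (if val s e \<noteq> 0 then exec orc p s else exec orc p' s)"
| "exec orc (Loop e p) s = None"
| "exec orc (Query a b m n) s =
    (case orc (val s a, val s b) of None \<Rightarrow> None | Some (y, z) \<Rightarrow> Some (1, s(m := y, n := z)))"

section \<open>Bit lengths and uniform cost bounds\<close>

lemma bits_mono: "m \<le> n \<Longrightarrow> bits m \<le> bits n"
  by (rule floorlog_mono)

lemma bits_ge_1: "1 \<le> n \<Longrightarrow> 1 \<le> bits n"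
  using floorlog_eq_zero_iff[of 2 n] by simp

lemma bits_power:
  assumes "1 \<le> n" "1 \<le> k"
  shows "bits (n ^ k) \<le> k * bits n"
proof (rule floorlog_leI)
  have "n < 2 ^ bits n" using floorlog_bounds[of n 2] assms by simp
  then have "n ^ k < (2 ^ bits n) ^ k" using assms by (intro power_strict_mono) auto
  then show "n ^ k < 2 ^ (k * bits n)" by (simp add: power_mult[symmetric] mult.commute)
qed simp_all

lemma bits_le_power:
  assumes "m \<le> n ^ k" "1 \<le> n" "1 \<le> k"
  shows "bits m \<le> k * bits n"
  using bits_mono[OF assms(1)] bits_power[OF assms(2,3)] by linarith

lemma less_two_power_le: "2 \<le> n \<Longrightarrow> k \<le> n ^ k" for k n :: nat
  using less_exp[of k] power_mono[of 2 n k] by linarith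

text \<open>The result of each operation is at most the product of the two bounds; for
  \<open>Plus\<close> this uses that both bounds are at least 2.\<close>

lemma arith_le_power:
  assumes "2 \<le> n" "1 \<le> i" "1 \<le> j" "x \<le> n ^ i" "y \<le> n ^ j"
  shows "arith f x y \<le> n ^ (i + j)"
proof -
  have ij: "n \<le> n ^ i" "n \<le> n ^ j" using assms(1-3) by (simp_all add: self_le_power)
  have prod: "u \<le> u * w" "w \<le> u * w" "u + w \<le> u * w" if "2 \<le> u" "2 \<le> w" for u w :: nat
  proof -
    define u' w' where "u' = u - 2" and "w' = w - 2"
    then have "u = u' + 2" "w = w' + 2" using that by simp_all
    then show "u \<le> u * w" "w \<le> u * w" "u + w \<le> u * w" by (simp_all add: algebra_simps)
  qed
  have big: "2 \<le> n ^ i" "2 \<le> n ^ j" using ij assms(1) by linarith+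
  note p = prod[OF big]
  show ?thesis
  proof (cases f)
    case Plus then show ?thesis using p(3) assms by (simp add: power_add)
  next
    case Minus then show ?thesis
      using order_trans[OF order_trans[OF diff_le_self assms(4)] p(1)] by (simp add: power_add)
  next
    case Times then show ?thesis using mult_le_mono[OF assms(4,5)] by (simp add: power_add)
  next
    case Quot then show ?thesis
      using order_trans[OF order_trans[OF div_le_dividend assms(4)] p(1)] by (simp add: power_add)
  next
    case Rem then show ?thesis
      using order_trans[OF order_trans[OF mod_less_eq_dividend assms(4)] p(1)] by (simp add: power_add)
  qed
qed

text \<open>\<open>K\<close> depends on the expression alone. Values are measured as powers of
  \<open>M\<close>: operations add exponents, bit lengths stay linear in \<open>bits M\<close>, and
  reading a cell falls back to the bound \<open>M\<close>.\<close>

lemma expr_bound: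
  "\<exists>K\<ge>1. \<forall>M s. 2 \<le> M \<longrightarrow> (\<forall>x. s x \<le> M) \<longrightarrow> val s e \<le> M ^ K \<and> cost s e \<le> K * bits M"
proof (induction e)
  case (Lit n)
  show ?case
  proof (intro exI[of _ "n + 1 + bits n"] conjI allI impI)
    fix M :: nat and s :: mem assume M: "2 \<le> M"
    have "n \<le> M ^ n" using M by (rule less_two_power_le)
    also have "\<dots> \<le> M ^ (n + 1 + bits n)" using M by (intro power_increasing) auto
    finally show "val s (Lit n) \<le> M ^ (n + 1 + bits n)" by simp
    have "1 + bits n \<le> (n + 1 + bits n) * 1" by simp
    also have "\<dots> \<le> (n + 1 + bits n) * bits M" using M bits_ge_1[of M] by (intro mult_le_mono) auto
    finally show "cost s (Lit n) \<le> (n + 1 + bits n) * bits M" by simp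
  qed simp
next
  case (Cell e)
  then obtain K where K: "1 \<le> K" "\<And>M s. 2 \<le> M \<Longrightarrow> \<forall>x. s x \<le> M \<Longrightarrow> val s e \<le> M ^ K \<and> cost s e \<le> K * bits M"
    by blast
  show ?case
  proof (intro exI[of _ "K + 2"] conjI allI impI)
    fix M :: nat and s :: mem assume M: "2 \<le> M" "\<forall>x. s x \<le> M"
    have "s (val s e) \<le> M ^ 1" using M by simp
    also have "\<dots> \<le> M ^ (K + 2)" using M by (intro power_increasing) auto
    finally show "val s (Cell e) \<le> M ^ (K + 2)" by simp
    have "bits (s (val s e)) \<le> bits M" using M by (intro bits_mono) auto
    then show "cost s (Cell e) \<le> (K + 2) * bits M"
      using K(2)[OF M] bits_ge_1[of M] M by simp
  qed simp
next
  case (Arith f e e')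
  then obtain K K'
    where K: "1 \<le> K" "\<And>M s. 2 \<le> M \<Longrightarrow> \<forall>x. s x \<le> M \<Longrightarrow> val s e \<le> M ^ K \<and> cost s e \<le> K * bits M"
      and K': "1 \<le> K'" "\<And>M s. 2 \<le> M \<Longrightarrow> \<forall>x. s x \<le> M \<Longrightarrow> val s e' \<le> M ^ K' \<and> cost s e' \<le> K' * bits M"
    by blast
  show ?case
  proof (intro exI[of _ "2 * (K + K') + 1"] conjI allI impI)
    fix M :: nat and s :: mem assume M: "2 \<le> M" "\<forall>x. s x \<le> M"
    have v: "arith f (val s e) (val s e') \<le> M ^ (K + K')"
      using K(2)[OF M] K'(2)[OF M] K(1) K'(1) M by (intro arith_le_power) auto
    also have "\<dots> \<le> M ^ (2 * (K + K') + 1)" using M by (intro power_increasing) auto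
    finally show "val s (Arith f e e') \<le> M ^ (2 * (K + K') + 1)" by simp
    have "bits (arith f (val s e) (val s e')) \<le> (K + K') * bits M"
      using v M K(1) by (intro bits_le_power) auto
    then show "cost s (Arith f e e') \<le> (2 * (K + K') + 1) * bits M"
      using K(2)[OF M] K'(2)[OF M] bits_ge_1[of M] M by (simp add: algebra_simps)
  qed simp
qed

definition orc_bounded :: "nat \<Rightarrow> (nat \<times> nat \<rightharpoonup> nat \<times> nat) \<Rightarrow> bool" where
  "orc_bounded M orc \<longleftrightarrow> (\<forall>z x y. orc z = Some (x, y) \<longrightarrow> x \<le> M \<and> y \<le> M)"

text \<open>The bound \<open>M ^ K\<close> on the final memory makes the notion composable: the next
  program starts from a larger bound, whose bit length has grown at most by the factor
  \<open>K\<close>.\<close>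

definition exec_bounded :: "nat \<Rightarrow> prog \<Rightarrow> bool" where
  "exec_bounded K p \<longleftrightarrow> 1 \<le> K \<and> (\<forall>M orc s q s'. 2 \<le> M \<longrightarrow> (\<forall>x. s x \<le> M) \<longrightarrow> orc_bounded M orc \<longrightarrow>
     exec orc p s = Some (q, s') \<longrightarrow> (\<exists>T\<le>K * bits M. run orc p s T q s') \<and> (\<forall>x. s' x \<le> M ^ K))"

lemma exec_boundedD:
  assumes "exec_bounded K p" "2 \<le> M" "\<forall>x. s x \<le> M" "orc_bounded M orc" "exec orc p s = Some (q, s')"
  obtains T where "T \<le> K * bits M" "run orc p s T q s'" "\<forall>x. s' x \<le> M ^ K"
  using assms unfolding exec_bounded_def by blast

lemma exec_boundedI:
  assumes "1 \<le> K"
    and "\<And>M orc s q s'. \<lbrakk>2 \<le> M; \<forall>x. s x \<le> M; orc_bounded M orc; exec orc p s = Some (q, s'); 1 \<le> bits M;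
      M \<le> M ^ K\<rbrakk> \<Longrightarrow> (\<exists>T\<le>K * bits M. run orc p s T q s') \<and> (\<forall>x. s' x \<le> M ^ K)"
  shows "exec_bounded K p"
  unfolding exec_bounded_def
proof (intro conjI[OF assms(1)] allI impI)
  fix M orc s q s'
  assume M: "2 \<le> M" "\<forall>x. s x \<le> M" "orc_bounded M orc" "exec orc p s = Some (q, s')"
  then have "1 \<le> bits M" "M \<le> M ^ K" using assms(1) by (simp_all add: bits_ge_1 self_le_power del: One_nat_def)
  with M show "(\<exists>T\<le>K * bits M. run orc p s T q s') \<and> (\<forall>x. s' x \<le> M ^ K)" by (rule assms(2))
qed

lemma exec_bounded_exists: "\<exists>K. exec_bounded K p"
proof (induction p)
  case Skip
  have "exec_bounded 1 Skip"
    by (rule exec_boundedI) (auto intro!: exI[of _ 1] run.Skip)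
  then show ?case ..
next
  case (Store a e)
  obtain K K'
    where K: "1 \<le> K" "\<And>M s. 2 \<le> M \<Longrightarrow> \<forall>x. s x \<le> M \<Longrightarrow> val s a \<le> M ^ K \<and> cost s a \<le> K * bits M"
      and K': "1 \<le> K'" "\<And>M s. 2 \<le> M \<Longrightarrow> \<forall>x. s x \<le> M \<Longrightarrow> val s e \<le> M ^ K' \<and> cost s e \<le> K' * bits M"
    using expr_bound by metis
  have "exec_bounded (K + K' + 1) (Store a e)"
  proof (rule exec_boundedI)
    fix M orc s q s'
    assume M: "2 \<le> M" "\<forall>x. s x \<le> M" and 1: "1 \<le> bits M" "M \<le> M ^ (K + K' + 1)"
      and ex: "exec orc (Store a e) s = Some (q, s')"
    note b = K(2)[OF M] K'(2)[OF M]
    have "M ^ K' \<le> M ^ (K + K' + 1)" using M by (intro power_increasing) auto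
    then have "val s e \<le> M ^ (K + K' + 1)" using b by linarith
    moreover have "s x \<le> M ^ (K + K' + 1)" for x using M 1 order_trans by blast
    ultimately have "\<forall>x. s' x \<le> M ^ (K + K' + 1)" using ex by auto
    moreover have "cost s a + cost s e + 1 \<le> (K + K' + 1) * bits M"
      using b 1 by (simp add: algebra_simps)
    ultimately show "(\<exists>T\<le>(K + K' + 1) * bits M. run orc (Store a e) s T q s') \<and> (\<forall>x. s' x \<le> M ^ (K + K' + 1))"
      using run.Store[of orc a e s] ex by auto
  qed simp
  then show ?case ..
next
  case (Seq p p')
  then obtain K K' where K: "exec_bounded K p" and K': "exec_bounded K' p'" by blast
  then have 1: "1 \<le> K" "1 \<le> K'" by (simp_all add: exec_bounded_def)
  \<comment> \<open>The second program runs under the bound \<open>M ^ K\<close>, which turns its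
    constant into \<open>K' * K\<close>.\<close>
  have "exec_bounded (K + K' * K + 1) (Seq p p')"
  proof (rule exec_boundedI)
    fix M orc s q s'
    assume M: "2 \<le> M" "\<forall>x. s x \<le> M" and orc: "orc_bounded M orc" and b: "1 \<le> bits M"
      and ex: "exec orc (Seq p p') s = Some (q, s')"
    from ex obtain q1 s1 q2 where ex: "exec orc p s = Some (q1, s1)" "exec orc p' s1 = Some (q2, s')" "q = q1 + q2"
      by (auto split: option.splits)
    obtain T where T: "T \<le> K * bits M" "run orc p s T q1 s1" "\<forall>x. s1 x \<le> M ^ K"
      by (rule exec_boundedD[OF K M orc ex(1)])
    have MK: "M \<le> M ^ K" using M 1 by (simp add: self_le_power)
    then have "2 \<le> M ^ K" "orc_bounded (M ^ K) orc"
      using M orc unfolding orc_bounded_def by (force intro: order_trans)+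
    then obtain T' where T': "T' \<le> K' * bits (M ^ K)" "run orc p' s1 T' q2 s'" "\<forall>x. s' x \<le> (M ^ K) ^ K'"
      using exec_boundedD[OF K' _ T(3) _ ex(2)] by blast
    have "K' * bits (M ^ K) \<le> K' * (K * bits M)" using M 1 by (intro mult_le_mono2 bits_power) auto
    with T'(1) have "T' \<le> K' * (K * bits M)" by (rule order_trans)
    then have "T + T' + 1 \<le> (K + K' * K + 1) * bits M" using T(1) b by (simp add: algebra_simps)
    moreover have "M ^ (K * K') \<le> M ^ (K + K' * K + 1)" using M by (intro power_increasing) auto
    then have "\<forall>x. s' x \<le> M ^ (K + K' * K + 1)"
      using T'(3) by (metis order_trans power_mult)
    ultimately show "(\<exists>T\<le>(K + K' * K + 1) * bits M. run orc (Seq p p') s T q s') \<and> (\<forall>x. s' x \<le> M ^ (K + K' * K + 1))"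
      using run.Seq[OF T(2) T'(2)] ex(3) by blast
  qed simp
  then show ?case ..
next
  case (Cond e p p')
  then obtain K K' where K: "exec_bounded K p" and K': "exec_bounded K' p'" by blast
  obtain L where L: "1 \<le> L" "\<And>M s. 2 \<le> M \<Longrightarrow> \<forall>x. s x \<le> M \<Longrightarrow> cost s e \<le> L * bits M"
    using expr_bound by metis
  let ?K = "L + K + K' + 1"
  have "exec_bounded ?K (Cond e p p')"
  proof (rule exec_boundedI)
    fix M orc s q s'
    assume M: "2 \<le> M" "\<forall>x. s x \<le> M" and orc: "orc_bounded M orc" and b: "1 \<le> bits M"
      and ex: "exec orc (Cond e p p') s = Some (q, s')"
    have mono: "K * bits M \<le> (K + K') * bits M" "K' * bits M \<le> (K + K') * bits M"
      by (simp_all add: algebra_simps)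
    have pow: "M ^ K \<le> M ^ ?K" "M ^ K' \<le> M ^ ?K" using M by (intro power_increasing; simp)+
    have "\<exists>T\<le>(K + K') * bits M. run orc (Cond e p p') s (cost s e + T + 1) q s' \<and> (\<forall>x. s' x \<le> M ^ ?K)"
    proof (cases "val s e = 0")
      case True
      then have "exec orc p' s = Some (q, s')" using ex by simp
      then obtain T where "T \<le> K' * bits M" "run orc p' s T q s'" "\<forall>x. s' x \<le> M ^ K'"
        by (rule exec_boundedD[OF K' M orc])
      then show ?thesis using run.CondFalse[OF True] mono pow order_trans by meson
    next
      case False
      then have "exec orc p s = Some (q, s')" using ex by simp
      then obtain T where "T \<le> K * bits M" "run orc p s T q s'" "\<forall>x. s' x \<le> M ^ K"
        by (rule exec_boundedD[OF K M orc])
      then show ?thesis using run.CondTrue[OF False] mono pow order_trans by meson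
    qed
    then obtain T where T: "T \<le> (K + K') * bits M" "run orc (Cond e p p') s (cost s e + T + 1) q s'"
      "\<forall>x. s' x \<le> M ^ ?K" by blast
    then have "cost s e + T + 1 \<le> ?K * bits M" using L(2)[OF M] b by (simp add: algebra_simps)
    then show "(\<exists>T\<le>?K * bits M. run orc (Cond e p p') s T q s') \<and> (\<forall>x. s' x \<le> M ^ ?K)"
      using T(2,3) by blast
  qed simp
  then show ?case ..
next
  case (Loop e p)
  \<comment> \<open>\<open>exec\<close> is undefined on loops, so this holds vacuously; loops are
    treated through \<open>loop_bounded\<close>.\<close>
  have "exec_bounded 1 (Loop e p)" by (rule exec_boundedI) auto
  then show ?case ..
next
  case (Query a b m n)
  obtain K K'
    where K: "\<And>M s. 2 \<le> M \<Longrightarrow> \<forall>x. s x \<le> M \<Longrightarrow> cost s a \<le> K * bits M"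
      and K': "\<And>M s. 2 \<le> M \<Longrightarrow> \<forall>x. s x \<le> M \<Longrightarrow> cost s b \<le> K' * bits M"
    using expr_bound by metis
  have "exec_bounded (K + K' + 1) (Query a b m n)"
  proof (rule exec_boundedI)
    fix M orc s q s'
    assume M: "2 \<le> M" "\<forall>x. s x \<le> M" and 1: "1 \<le> bits M" "M \<le> M ^ (K + K' + 1)"
      and orc: "orc_bounded M orc" and ex: "exec orc (Query a b m n) s = Some (q, s')"
    from ex obtain y z where yz: "orc (val s a, val s b) = Some (y, z)" "q = 1" "s' = s(m := y, n := z)"
      by (auto split: option.splits)
    have "y \<le> M" "z \<le> M" using orc yz(1) by (auto simp: orc_bounded_def)
    then have "s' x \<le> M" for x using M yz(3) by simp
    then have "\<forall>x. s' x \<le> M ^ (K + K' + 1)" using 1(2) order_trans by blast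
    moreover have "cost s a + cost s b + 1 \<le> (K + K' + 1) * bits M"
      using K[OF M] K'[OF M] 1 by (simp add: algebra_simps)
    ultimately show "(\<exists>T\<le>(K + K' + 1) * bits M. run orc (Query a b m n) s T q s') \<and> (\<forall>x. s' x \<le> M ^ (K + K' + 1))"
      using run.Query[of orc s a b y z m n, OF yz(1)] unfolding yz(2,3) by blast
  qed simp
  then show ?case ..
qed

text \<open>The big-step semantics has no states between the iterations of a loop. They are
  recovered from the far end: every halting run from \<open>s'\<close> yields one from
  \<open>s\<close> with the same final memory, at an extra cost of at most \<open>c\<close> steps
  and \<open>q\<close> queries.\<close>

definition reach ::
  "(nat \<times> nat \<rightharpoonup> nat \<times> nat) \<Rightarrow> prog \<Rightarrow> mem \<Rightarrow> nat \<Rightarrow> nat \<Rightarrow> mem \<Rightarrow> bool" where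
  "reach orc p s c q s' \<longleftrightarrow> (\<forall>T Q s''. run orc p s' T Q s'' \<longrightarrow>
     (\<exists>T' Q'. T' \<le> T + c \<and> Q' \<le> Q + q \<and> run orc p s T' Q' s''))"

lemma reach_refl: "reach orc p s 0 0 s"
  by (auto simp: reach_def)

lemma reach_trans:
  assumes "reach orc p s c q s'" "reach orc p s' c' q' s''"
  shows "reach orc p s (c + c') (q + q') s''"
  unfolding reach_def
proof (intro allI impI)
  fix T Q r assume "run orc p s'' T Q r"
  then obtain T1 Q1 where 1: "T1 \<le> T + c'" "Q1 \<le> Q + q'" "run orc p s' T1 Q1 r"
    using assms(2) unfolding reach_def by blast
  then obtain T2 Q2 where "T2 \<le> T1 + c" "Q2 \<le> Q1 + q" "run orc p s T2 Q2 r"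
    using assms(1) unfolding reach_def by blast
  with 1 show "\<exists>T' Q'. T' \<le> T + (c + c') \<and> Q' \<le> Q + (q + q') \<and> run orc p s T' Q' r"
    by (intro exI[of _ T2] exI[of _ Q2]) auto
qed

lemma reach_mono:
  assumes "reach orc p s c q s'" "c \<le> c'" "q \<le> q'"
  shows "reach orc p s c' q' s'"
  unfolding reach_def
proof (intro allI impI)
  fix T Q r assume "run orc p s' T Q r"
  then obtain T1 Q1 where "T1 \<le> T + c" "Q1 \<le> Q + q" "run orc p s T1 Q1 r"
    using assms(1) unfolding reach_def by blast
  with assms(2,3) show "\<exists>T' Q'. T' \<le> T + c' \<and> Q' \<le> Q + q' \<and> run orc p s T' Q' r"
    by (intro exI[of _ T1] exI[of _ Q1]) auto
qed

text \<open>Collects the costs of the two possible events of a loop with loop-free body, leaving it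
  and performing one iteration, under a constant that does not depend on memory or oracle.\<close>

definition loop_bounded :: "nat \<Rightarrow> expr \<Rightarrow> prog \<Rightarrow> bool" where
  "loop_bounded K e p \<longleftrightarrow> (\<forall>M orc s. 2 \<le> M \<longrightarrow> (\<forall>x. s x \<le> M) \<longrightarrow> orc_bounded M orc \<longrightarrow>
     (val s e = 0 \<longrightarrow> (\<exists>T\<le>K * bits M. run orc (Loop e p) s T 0 s)) \<and>
     (\<forall>q s'. val s e \<noteq> 0 \<longrightarrow> exec orc p s = Some (q, s') \<longrightarrow> reach orc (Loop e p) s (K * bits M) q s'))"

lemma loop_bounded_exists: "\<exists>K. loop_bounded K e p"
proof -
  obtain K where K: "exec_bounded K p" using exec_bounded_exists by blast
  obtain L where L: "\<And>M s. 2 \<le> M \<Longrightarrow> \<forall>x. s x \<le> M \<Longrightarrow> cost s e \<le> L * bits M"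
    using expr_bound by metis
  have "loop_bounded (L + K + 1) e p"
    unfolding loop_bounded_def
  proof (intro allI impI conjI)
    fix M orc and s :: mem assume M: "2 \<le> M" "\<forall>x. s x \<le> M" and orc: "orc_bounded M orc"
    have b: "1 \<le> bits M" using M bits_ge_1 by simp
    {
      assume "val s e = 0"
      from run.LoopFalse[of s e orc p, OF this] L[OF M] b
      show "\<exists>T\<le>(L + K + 1) * bits M. run orc (Loop e p) s T 0 s"
        by (intro exI[of _ "cost s e + 1"]) (simp add: algebra_simps)
    next
      fix q s' assume e: "val s e \<noteq> 0" and "exec orc p s = Some (q, s')"
      then obtain T where T: "T \<le> K * bits M" "run orc p s T q s'"
        by (metis exec_boundedD[OF K M orc])
      show "reach orc (Loop e p) s ((L + K + 1) * bits M) q s'"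
        unfolding reach_def
      proof (intro allI impI)
        fix T' Q' r assume "run orc (Loop e p) s' T' Q' r"
        from run.LoopTrue[OF e T(2) this] L[OF M] b T(1)
        show "\<exists>T''  Q''. T'' \<le> T' + (L + K + 1) * bits M \<and> Q'' \<le> Q' + q \<and> run orc (Loop e p) s T'' Q'' r"
          by (intro exI[of _ "cost s e + T + T' + 1"] exI[of _ "q + Q'"]) (simp add: algebra_simps)
      qed
    }
  qed
  then show ?thesis ..
qed

section \<open>The stack machine\<close>

abbreviation reg :: "nat \<Rightarrow> expr" where "reg k \<equiv> Cell (Lit k)"
abbreviation set_reg :: "nat \<Rightarrow> expr \<Rightarrow> prog" where "set_reg k \<equiv> Store (Lit k)"
abbreviation plus_expr (infixl "\<oplus>" 65) where "a \<oplus> b \<equiv> Arith Plus a b"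
abbreviation minus_expr (infixl "\<ominus>" 65) where "a \<ominus> b \<equiv> Arith Minus a b"
abbreviation times_expr (infixl "\<otimes>" 70) where "a \<otimes> b \<equiv> Arith Times a b"
abbreviation quot_expr (infixl "\<oslash>" 70) where "a \<oslash> b \<equiv> Arith Quot a b"
abbreviation rem_expr (infixl "\<odot>" 70) where "a \<odot> b \<equiv> Arith Rem a b"

fun block :: "prog list \<Rightarrow> prog" where
  "block [] = Skip"
| "block (p # ps) = Seq p (block ps)"

text \<open>
  Cells 0 and 1 hold \<open>t\<close> and \<open>D\<close>, cell 2 the vertex number, cell 3 the edge label of the outermost call,
  cell 4 the stack pointer, and cells 5 to 7 the size, the address of the first digit and the address of
  the edge label of the current call; cell 8 holds \<open>D\<^sup>8\<close> while digits are split off or joined. The digits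
  occupy the cells from 16 on, most significant first, and the stack those from \<open>16 + t\<close> on. From the
  bottom, a stack entry consists of a label address, a digit address and the size of the call. Size 0
  marks the second half of a zig-zag step: its digit is that of the cloud, and four more cells below
  hold the labels rewritten by the recursive calls.
\<close>

definition leaf1_prog :: prog where
  "leaf1_prog = block
    [Query (Cell (reg 6)) (Cell (reg 7) \<oslash> reg 1) 10 11,
     Query (reg 10) (Cell (reg 7) \<odot> reg 1) 10 12,
     Store (reg 6) (reg 10),
     Store (reg 7) (reg 12 \<otimes> reg 1 \<oplus> reg 11)]"

definition leaf2_prog :: prog where
  "leaf2_prog = block
    [Query (Cell (reg 6)) (Cell (reg 7) \<oslash> reg 1) 10 11,
     Store (reg 6) (reg 10),
     Query (Cell (reg 6 \<oplus> Lit 1)) (Cell (reg 7) \<odot> reg 1) 10 12,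
     Store (reg 6 \<oplus> Lit 1) (reg 10),
     Store (reg 7) (reg 11 \<otimes> reg 1 \<oplus> reg 12)]"

text \<open>The opening move of a zig-zag step queries \<open>H\<close> at the cloud digit, the last
  of the string. The answer stays in register 10 as an edge label of the large graph, while the
  label cell receives the new first half next to the unchanged second half.\<close>

definition compute_prog :: prog where
  "compute_prog = block
    [set_reg 9 (reg 6 \<oplus> reg 5 \<ominus> Lit 1),
     Query (Cell (reg 9)) (Cell (reg 7) \<oslash> reg 1) 10 11,
     Store (reg 7) (reg 11 \<otimes> reg 1 \<oplus> Cell (reg 7) \<odot> reg 1),
     set_reg 12 (reg 1 \<otimes> reg 1),
     set_reg 13 (reg 5 \<oslash> Lit 2),
     set_reg 14 ((reg 5 \<ominus> Lit 1) \<oslash> Lit 2),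
     set_reg 15 (reg 6 \<oplus> reg 13)]"

text \<open>Register 4 is advanced only at the end, so every expression sees the old stack
  pointer.\<close>

fun push_from :: "nat \<Rightarrow> expr list \<Rightarrow> prog" where
  "push_from j [] = set_reg 4 (reg 4 \<oplus> Lit j)"
| "push_from j (e # es) = Seq (Store (reg 4 \<oplus> Lit j) e) (push_from (Suc j) es)"

text \<open>Such expressions read only fixed cells below 16, hence keep their values while the stack
  above is being written.\<close>

fun reg_expr :: "expr \<Rightarrow> bool" where
  "reg_expr (Lit n) \<longleftrightarrow> True"
| "reg_expr (Cell e) \<longleftrightarrow> (case e of Lit k \<Rightarrow> k < 16 | _ \<Rightarrow> False)"
| "reg_expr (Arith f a b) \<longleftrightarrow> reg_expr a \<and> reg_expr b"

lemma val_reg_expr: "reg_expr e \<Longrightarrow> \<forall>k<16. s' k = s k \<Longrightarrow> val s' e = val s e"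
  by (induction e) (auto split: expr.splits)

lemma exec_push_from:
  assumes "s 4 = p" "16 \<le> p" "\<forall>e\<in>set es. reg_expr e"
  shows "\<exists>s'. exec orc (push_from j es) s = Some (0, s') \<and> s' 4 = p + j + length es \<and>
    (\<forall>i<length es. s' (p + j + i) = val s (es ! i)) \<and>
    (\<forall>x. x \<noteq> 4 \<longrightarrow> x < p + j \<or> p + j + length es \<le> x \<longrightarrow> s' x = s x)"
  using assms
proof (induction es arbitrary: j s)
  case Nil
  then show ?case by auto
next
  case (Cons e es)
  let ?s = "s(p + j := val s e)"
  have "?s 4 = p" "\<forall>e\<in>set es. reg_expr e" using Cons.prems by simp_all
  from Cons.IH[where s = ?s and j = "Suc j", OF this(1) Cons.prems(2) this(2)] obtain s' where s': "exec orc (push_from (Suc j) es) ?s = Some (0, s')"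
    "s' 4 = p + Suc j + length es" "\<forall>i<length es. s' (p + Suc j + i) = val ?s (es ! i)"
    "\<forall>x. x \<noteq> 4 \<longrightarrow> x < p + Suc j \<or> p + Suc j + length es \<le> x \<longrightarrow> s' x = ?s x"
    by blast
  have "val ?s (es ! i) = val s (es ! i)" if "i < length es" for i
    using Cons.prems that by (intro val_reg_expr) auto
  then have "s' (p + j + i) = val s ((e # es) ! i)" if "i < length (e # es)" for i
    using s'(3,4) Cons.prems(2) that by (cases i) auto
  then show ?case using s' Cons.prems(1,2) by (intro exI[of _ s']) auto
qed

text \<open>Register 12 holds \<open>D\<^sup>2\<close>: the edge label of the squared tensor product
  is cut into four digits in this base, stored in the lowest cells. The pending entries are pushed
  in reverse order of execution, so the call of the first factor on the leading digit ends up on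
  top.\<close>

definition push_exprs :: "expr list" where
  "push_exprs =
    [reg 10 \<oslash> reg 12 \<oslash> reg 12 \<oslash> reg 12,
     reg 10 \<oslash> reg 12 \<oslash> reg 12 \<odot> reg 12,
     reg 10 \<oslash> reg 12 \<odot> reg 12,
     reg 10 \<odot> reg 12,
     reg 7, reg 9, Lit 0,
     reg 4 \<oplus> Lit 3, reg 15, reg 14,
     reg 4 \<oplus> Lit 2, reg 6, reg 13,
     reg 4 \<oplus> Lit 1, reg 15, reg 14,
     reg 4, reg 6, reg 13]"

definition expand_prog :: prog where
  "expand_prog = Seq compute_prog (push_from 0 push_exprs)"

text \<open>The four returned labels are joined in the order 2, 3, 0, 1, because a square lists the
  label of its second step first. Likewise the final label has the new second half in front, as in
  the zig-zag product.\<close>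

definition finish_prog :: prog where
  "finish_prog = block
    [set_reg 4 (reg 4 \<ominus> Lit 4),
     set_reg 12 (reg 1 \<otimes> reg 1),
     set_reg 10 (Cell (reg 4 \<oplus> Lit 2) \<otimes> reg 12 \<oplus> Cell (reg 4 \<oplus> Lit 3)),
     set_reg 10 (reg 10 \<otimes> reg 12 \<oplus> Cell (reg 4)),
     set_reg 10 (reg 10 \<otimes> reg 12 \<oplus> Cell (reg 4 \<oplus> Lit 1)),
     Query (reg 10) (Cell (reg 7) \<odot> reg 1) 10 11,
     Store (reg 6) (reg 10),
     Store (reg 7) (reg 11 \<otimes> reg 1 \<oplus> Cell (reg 7) \<oslash> reg 1)]"

text \<open>Pops one entry and dispatches on its size. Truncated subtraction serves as comparison:
  once 0 is excluded, the tests separate 1, 2 and larger sizes.\<close>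

definition step_prog :: prog where
  "step_prog = block
    [set_reg 4 (reg 4 \<ominus> Lit 3),
     set_reg 7 (Cell (reg 4)),
     set_reg 6 (Cell (reg 4 \<oplus> Lit 1)),
     set_reg 5 (Cell (reg 4 \<oplus> Lit 2)),
     Cond (reg 5)
       (Cond (reg 5 \<ominus> Lit 1) (Cond (reg 5 \<ominus> Lit 2) expand_prog leaf2_prog) leaf1_prog)
       finish_prog]"

text \<open>\<open>M\<close> is to bound all cells. The stack starts at \<open>16 + t\<close> and
  needs at most \<open>19 * t\<close> cells, so its addresses stay within
  \<open>20 * t + 20\<close>; \<open>D ^ 8\<close> covers digits and labels.\<close>

locale machine =
  fixes H :: rgraph and D t M :: nat
  assumes reg: "regular_graph H" and nvH: "nv H = D ^ 8" and degH: "deg H = D"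
    and D1: "1 \<le> D" and M: "D ^ 8 + 20 * t + 20 \<le> M"
begin

definition good :: "mem \<Rightarrow> bool" where
  "good s \<longleftrightarrow> s 0 = t \<and> s 1 = D \<and> (\<forall>x. s x \<le> M)"

text \<open>The frame condition of a call: registers 4 to 15 are scratch, and below the stack level
  \<open>p\<close> only the cells in \<open>X\<close> may change besides them.\<close>

definition same :: "nat \<Rightarrow> nat set \<Rightarrow> mem \<Rightarrow> mem \<Rightarrow> bool" where
  "same p X s s' \<longleftrightarrow> (\<forall>x. (x < 4 \<or> 16 \<le> x) \<longrightarrow> x < p \<longrightarrow> x \<notin> X \<longrightarrow> s' x = s x)"

abbreviation "orc \<equiv> rot_oracle H"

lemma orc_eq: "x < D ^ 8 \<Longrightarrow> i < D \<Longrightarrow> orc (x, i) = Some (rot H (x, i))"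
  by (simp add: rot_oracle_def rdom_def nvH degH)

lemma rot_less:
  assumes "x < D ^ 8" "i < D" "rot H (x, i) = (y, j)"
  shows "y < D ^ 8" "j < D"
  using rot_in_rdom[OF reg, of x i] assms by (simp_all add: nvH degH)

lemma label_less: "i < D \<Longrightarrow> j < D \<Longrightarrow> i * D + j < D\<^sup>2"
  using enc_less[of i D j D] by (simp add: enc_def power2_eq_square)

lemma label_div_mod:
  assumes "e < D\<^sup>2"
  shows "e div D < D" "e mod D < D"
  using assms D1 by (simp_all add: power2_eq_square less_mult_imp_div_less)

lemma D2_le: "D\<^sup>2 \<le> D ^ 8"
  using D1 by (intro power_increasing) auto

lemma le_M: "x < D ^ 8 \<Longrightarrow> x \<le> M" "i < D \<Longrightarrow> i \<le> M" "e < D\<^sup>2 \<Longrightarrow> e \<le> M" "D \<le> M"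
proof -
  have "D \<le> D\<^sup>2" using D1 by (simp add: self_le_power)
  then show "x < D ^ 8 \<Longrightarrow> x \<le> M" "i < D \<Longrightarrow> i \<le> M" "e < D\<^sup>2 \<Longrightarrow> e \<le> M" "D \<le> M"
    using M D2_le by linarith+
qed

lemma goodD:
  assumes "good s"
  shows "s 0 = t" "s (Suc 0) = D" "s x \<le> M"
  using assms by (auto simp: good_def)

section \<open>Single iterations of the main loop\<close>

lemma exec_leaf1:
  assumes s: "good s" "s 4 = p + 3" "s p = L" "s (p + 1) = off" "s (p + 2) = 1"
    and addr: "16 \<le> off" "off < p" "L = 3 \<or> 16 \<le> L" "L < p" "L \<noteq> off" "p \<le> M"
    and bnd: "s off < D ^ 8" "s L < D\<^sup>2"
    and r1: "rot H (s off, s L div D) = (x1, l1)" and r2: "rot H (x1, s L mod D) = (x2, l2)"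
  shows "\<exists>s'. exec orc step_prog s = Some (2, s') \<and> good s' \<and> s' 4 = p \<and>
    s' off = x2 \<and> s' L = l2 * D + l1 \<and> same p {L, off} s s'"
proof -
  note lab = label_div_mod[OF bnd(2)]
  note b1 = rot_less[OF bnd(1) lab(1) r1]
  note b2 = rot_less[OF b1(1) lab(2) r2]
  have orc: "orc (s off, s L div D) = Some (x1, l1)" "orc (x1, s L mod D) = Some (x2, l2)"
    using orc_eq bnd lab b1 r1 r2 by simp_all
  \<comment> \<open>The label lies in cell 3 or beyond the registers, so scratch writes cannot
    disturb it.\<close>
  have Lk: "L \<noteq> k" "k \<noteq> L" if "4 \<le> k" "k < 16" for k using addr that by auto
  note 1 = goodD[OF s(1)]
  have 2: "s (p + 2) = Suc 0" "s (Suc p) = off" "s (Suc (Suc p)) = Suc 0" using s by simp_all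
  note ms = le_M(1)[OF b1(1)] le_M(1)[OF b2(1)] le_M(2)[OF b1(2)] le_M(2)[OF b2(2)]
    le_M(3)[OF label_less[OF b2(2) b1(2)]] le_M(4)
  show ?thesis
    using addr s(2-5) orc Lk 1 2 ms
    by (auto simp: step_prog_def leaf1_prog_def good_def same_def)
qed


lemma exec_leaf2:
  assumes s: "good s" "s 4 = p + 3" "s p = L" "s (p + 1) = off" "s (p + 2) = 2"
    and addr: "16 \<le> off" "off + 1 < p" "L = 3 \<or> 16 \<le> L" "L < p" "L \<noteq> off" "L \<noteq> off + 1" "p \<le> M"
    and bnd: "s off < D ^ 8" "s (off + 1) < D ^ 8" "s L < D\<^sup>2"
    and r1: "rot H (s off, s L div D) = (x1, l1)" and r2: "rot H (s (off + 1), s L mod D) = (x2, l2)"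
  shows "\<exists>s'. exec orc step_prog s = Some (2, s') \<and> good s' \<and> s' 4 = p \<and>
    s' off = x1 \<and> s' (off + 1) = x2 \<and> s' L = l1 * D + l2 \<and> same p {L, off, off + 1} s s'"
proof -
  note lab = label_div_mod[OF bnd(3)]
  note b1 = rot_less[OF bnd(1) lab(1) r1]
  note b2 = rot_less[OF bnd(2) lab(2) r2]
  have orc: "orc (s off, s L div D) = Some (x1, l1)" "orc (s (Suc off), s L mod D) = Some (x2, l2)"
    using orc_eq bnd lab r1 r2 by simp_all
  have Lk: "L \<noteq> k" "k \<noteq> L" if "4 \<le> k" "k < 16" for k using addr that by auto
  note 1 = goodD[OF s(1)]
  have 2: "s (p + 2) = 2" "s (Suc p) = off" "s (Suc (Suc p)) = 2" "off < p" using s addr by simp_all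
  note ms = le_M(1)[OF b1(1)] le_M(1)[OF b2(1)] le_M(2)[OF b1(2)] le_M(2)[OF b2(2)]
    le_M(3)[OF label_less[OF b1(2) b2(2)]] le_M(4)
  show ?thesis
    using addr s(2-4) orc Lk 1 2 ms M
    by (auto simp: step_prog_def leaf2_prog_def good_def same_def)
qed

lemma exec_finish:
  assumes s: "good s" "s 4 = p + 7" "s (p + 4) = L" "s (p + 5) = ka" "s (p + 6) = 0"
    and addr: "16 \<le> ka" "ka < p" "L = 3 \<or> 16 \<le> L" "L < p" "L \<noteq> ka" "p \<le> M"
    and bnd: "((s (p + 2) * D\<^sup>2 + s (p + 3)) * D\<^sup>2 + s p) * D\<^sup>2 + s (p + 1) < D ^ 8" "s L < D\<^sup>2"
    and r1: "rot H (((s (p + 2) * D\<^sup>2 + s (p + 3)) * D\<^sup>2 + s p) * D\<^sup>2 + s (p + 1), s L mod D) = (l, j)"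
  shows "\<exists>s'. exec orc step_prog s = Some (1, s') \<and> good s' \<and> s' 4 = p \<and>
    s' ka = l \<and> s' L = j * D + s L div D \<and> same p {L, ka} s s'"
proof -
  note lab = label_div_mod[OF bnd(2)]
  note b1 = rot_less[OF bnd(1) lab(2) r1]
  have orc: "orc (((s (p + 2) * (D * D) + s (p + 3)) * (D * D) + s p) * (D * D) + s (Suc p), s L mod D) = Some (l, j)"
    using orc_eq[OF bnd(1) lab(2)] r1 by (simp add: power2_eq_square)
  have Lk: "L \<noteq> k" "k \<noteq> L" if "4 \<le> k" "k < 16" for k using addr that by auto
  note 1 = goodD[OF s(1)]
  have 2: "s (4 + p) = L" "s (5 + p) = ka" "s (6 + p) = 0" using s by (simp_all add: add.commute)
  have "D\<^sup>2 \<le> M" using M D2_le by linarith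
  then have ms: "D * D \<le> M" by (simp add: power2_eq_square)
  show ?thesis
    using addr s(2-5) orc Lk 1 2 ms M le_M(1)[OF b1(1)] le_M(2)[OF b1(2)] le_M(3)[OF label_less[OF b1(2) lab(1)]] le_M(4)
    by (auto simp: step_prog_def finish_prog_def good_def same_def)
qed

lemma fun_upd_le: "(\<And>x. f x \<le> m) \<Longrightarrow> v \<le> m \<Longrightarrow> (f(a := v)) x \<le> m"
  by simp

lemma exec_push:
  assumes s: "s 4 = p" "s 5 = n" "s 6 = off" "s 7 = L" "s 9 = ka" "s 10 = k" "s 12 = d"
      "s 13 = a" "s 14 = b" "s 15 = ob"
    and p: "16 \<le> p" "p + 19 \<le> M" and sM: "\<And>x. s x \<le> M"
  shows "\<exists>s'. exec orc (push_from 0 push_exprs) s = Some (0, s') \<and> (\<forall>x. s' x \<le> M) \<and> s' 4 = p + 19 \<and>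
    (\<forall>x. x \<noteq> 4 \<longrightarrow> x < p \<longrightarrow> s' x = s x) \<and>
    s' p = k div d div d div d \<and> s' (p + 1) = k div d div d mod d \<and>
    s' (p + 2) = k div d mod d \<and> s' (p + 3) = k mod d \<and>
    s' (p + 4) = L \<and> s' (p + 5) = ka \<and> s' (p + 6) = 0 \<and>
    s' (p + 7) = p + 3 \<and> s' (p + 8) = ob \<and> s' (p + 9) = b \<and>
    s' (p + 10) = p + 2 \<and> s' (p + 11) = off \<and> s' (p + 12) = a \<and>
    s' (p + 13) = p + 1 \<and> s' (p + 14) = ob \<and> s' (p + 15) = b \<and>
    s' (p + 16) = p \<and> s' (p + 17) = off \<and> s' (p + 18) = a"
proof -
  have "\<forall>e\<in>set push_exprs. reg_expr e" by (simp add: push_exprs_def)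
  moreover have len: "length push_exprs = 19" by (simp add: push_exprs_def)
  ultimately have "\<exists>s'. exec orc (push_from 0 push_exprs) s = Some (0, s') \<and> s' 4 = p + 19 \<and>
      (\<forall>i<19. s' (p + i) = val s (push_exprs ! i)) \<and>
      (\<forall>x. x \<noteq> 4 \<longrightarrow> x < p \<or> p + 19 \<le> x \<longrightarrow> s' x = s x)"
    using exec_push_from[where s = s and es = push_exprs and j = 0 and orc = orc, OF s(1) p(1)] by simp
  then
  obtain s' where ex: "exec orc (push_from 0 push_exprs) s = Some (0, s')" and s'4: "s' 4 = p + 19"
    and vals: "\<And>i. i < 19 \<Longrightarrow> s' (p + i) = val s (push_exprs ! i)"
    and frame: "\<And>x. x \<noteq> 4 \<Longrightarrow> x < p \<or> p + 19 \<le> x \<Longrightarrow> s' x = s x"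
    by blast
  have "\<forall>e\<in>set push_exprs. val s e \<le> M"
    using p sM[of 10] sM[of 7] sM[of 9] sM[of 15] sM[of 14] sM[of 6] sM[of 13] s
    by (auto simp: push_exprs_def intro: order_trans[OF div_le_dividend] order_trans[OF mod_less_eq_dividend])
  then have "val s (push_exprs ! i) \<le> M" if "i < 19" for i
    using that len by simp
  then have "s' x \<le> M" for x
    using vals[of "x - p"] frame[of x] sM[of x] s'4 p
    by (cases "x = 4"; cases "x < p \<or> p + 19 \<le> x") auto
  then have "\<forall>x. s' x \<le> M" by blast
  moreover have
    "s' (p + 0) = k div d div d div d"
    "s' (p + 1) = k div d div d mod d"
    "s' (p + 2) = k div d mod d"
    "s' (p + 3) = k mod d"
    "s' (p + 4) = L"
    "s' (p + 5) = ka"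
    "s' (p + 6) = 0"
    "s' (p + 7) = p + 3"
    "s' (p + 8) = ob"
    "s' (p + 9) = b"
    "s' (p + 10) = p + 2"
    "s' (p + 11) = off"
    "s' (p + 12) = a"
    "s' (p + 13) = p + 1"
    "s' (p + 14) = ob"
    "s' (p + 15) = b"
    "s' (p + 16) = p"
    "s' (p + 17) = off"
    "s' (p + 18) = a"
    using vals[of 0] vals[of 1] vals[of 2] vals by (simp_all add: push_exprs_def s)
  moreover have "s' p = k div d div d div d" using vals[of 0] by (simp add: push_exprs_def s)
  moreover have "\<forall>x. x \<noteq> 4 \<longrightarrow> x < p \<longrightarrow> s' x = s x" using frame by blast
  ultimately show ?thesis
    using ex s'4 by (intro exI[of _ s'] conjI)
qed

lemma exec_expand:
  assumes s: "good s" "s 4 = p + 3" "s p = L" "s (p + 1) = off" "s (p + 2) = n"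
    and n: "3 \<le> n" and addr: "16 \<le> off" "off + n \<le> p" "L = 3 \<or> 16 \<le> L" "L < p" "L < off \<or> off + n \<le> L"
    and pM: "p + 19 \<le> M"
    and bnd: "s (off + n - 1) < D ^ 8" "s L < D\<^sup>2"
    and r1: "rot H (s (off + n - 1), s L div D) = (k, i)"
  shows "\<exists>s'. exec orc step_prog s = Some (1, s') \<and> good s' \<and> s' 4 = p + 19 \<and>
    s' L = i * D + s L mod D \<and> same p {L} s s' \<and>
    s' p = k div D\<^sup>2 div D\<^sup>2 div D\<^sup>2 \<and> s' (p + 1) = k div D\<^sup>2 div D\<^sup>2 mod D\<^sup>2 \<and>
    s' (p + 2) = k div D\<^sup>2 mod D\<^sup>2 \<and> s' (p + 3) = k mod D\<^sup>2 \<and>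
    s' (p + 4) = L \<and> s' (p + 5) = off + n - 1 \<and> s' (p + 6) = 0 \<and>
    s' (p + 7) = p + 3 \<and> s' (p + 8) = off + n div 2 \<and> s' (p + 9) = (n - 1) div 2 \<and>
    s' (p + 10) = p + 2 \<and> s' (p + 11) = off \<and> s' (p + 12) = n div 2 \<and>
    s' (p + 13) = p + 1 \<and> s' (p + 14) = off + n div 2 \<and> s' (p + 15) = (n - 1) div 2 \<and>
    s' (p + 16) = p \<and> s' (p + 17) = off \<and> s' (p + 18) = n div 2"
proof -
  note lab = label_div_mod[OF bnd(2)]
  note b1 = rot_less[OF bnd(1) lab(1) r1]
  define ka where "ka = off + n - 1"
  define a b ob where ab: "a = n div 2" "b = (n - Suc 0) div 2" "ob = off + a"
  define c0 c1 c2 c3 where c: "c0 = k div (D * D) div (D * D) div (D * D)"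
    "c1 = k div (D * D) div (D * D) mod (D * D)" "c2 = k div (D * D) mod (D * D)" "c3 = k mod (D * D)"
  have orc: "orc (s ka, s L div D) = Some (k, i)"
    using orc_eq[OF bnd(1) lab(1)] r1 by (simp add: ka_def)
  have Lk: "L \<noteq> k" if "4 \<le> k" "k < 16" for k using addr that by auto
  have L1: "Suc 0 \<noteq> L" using addr by auto
  have ka: "16 \<le> ka" "ka < p" "ka \<noteq> L" and ka_eq: "off + n - Suc 0 = ka"
    using n addr by (auto simp: ka_def)
  note 1 = goodD[OF s(1)]
  have Dk: "D * D \<le> D ^ 8" using D2_le by (simp add: power2_eq_square)
  have "k \<le> M" using le_M(1)[OF b1(1)] .
  then have ms: "D * D \<le> M" "c0 \<le> M" "c1 \<le> M" "c2 \<le> M" "c3 \<le> M" "a \<le> M" "b \<le> M" "ob \<le> M" "ka \<le> M"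
      "i * D + s L mod D \<le> M" "n \<le> M" "off \<le> M" "L \<le> M"
    using M Dk pM addr n le_M(3)[OF label_less[OF b1(2) lab(2)]] ka
    by (auto simp: c ab intro: order_trans[OF div_le_dividend] order_trans[OF mod_less_eq_dividend]
        simp: div_mult2_eq[symmetric] simp del: div_mult_self1)
  have 2: "s (Suc p) = off" "s (Suc (Suc p)) = n" "s (p + 2) = n" and n0: "0 < n" "n - Suc 0 \<noteq> 0" "n - 2 \<noteq> 0"
    using s n by simp_all
  have pk: "p \<noteq> k" "p + j \<noteq> k" "k \<noteq> p" "k \<noteq> p + j" if "k < 16" for k j using addr n that by auto
  have kak: "ka \<noteq> k" "k \<noteq> ka" if "k < 16" for k using ka that by auto
  \<comment> \<open>\<open>s1\<close> is the memory after popping the entry, \<open>s2\<close> the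
    memory just before the pushes.\<close>
  define s1 where "s1 = s(4 := p, 7 := L, 6 := off, 5 := n)"
  define s2 where "s2 = s1(9 := ka, 10 := k, 11 := i, L := i * D + s L mod D, 12 := D * D, 13 := a, 14 := b, 15 := ob)"
  have e1: "exec orc step_prog s = exec orc expand_prog s1"
    using s(2-3) 2 pk n0 by (simp add: step_prog_def s1_def split: option.split)
  have s1: "s1 4 = p" "s1 7 = L" "s1 6 = off" "s1 5 = n" "s1 (Suc 0) = D" "s1 L = s L" "s1 ka = s ka"
    using Lk kak 1(2) by (simp_all add: s1_def)
  have e2: "exec orc compute_prog s1 = Some (1, s2)"
    using s1 Lk L1 kak orc 2 n0 ka_eq 1(2) by (simp add: compute_prog_def s2_def ab)
  have sM: "s x \<le> M" for x using s(1) by (auto simp: good_def)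
  have s2M: "s2 x \<le> M" for x
    unfolding s2_def s1_def
    by (intro fun_upd_le sM ms le_M(1)[OF b1(1)] le_M(2)[OF b1(2)]) (use pM in simp)
  have s2: "s2 4 = p" "s2 5 = n" "s2 6 = off" "s2 7 = L" "s2 9 = ka" "s2 10 = k" "s2 12 = D * D"
    "s2 13 = a" "s2 14 = b" "s2 15 = ob" "s2 L = i * D + s L mod D"
    using Lk by (simp_all add: s2_def s1_def)
  have "16 \<le> p" using addr n by linarith
  from exec_push[OF s2(1-10) this pM s2M]
  obtain s' where ex: "exec orc (push_from 0 push_exprs) s2 = Some (0, s')"
    and s'M: "\<forall>x. s' x \<le> M" and s': "s' 4 = p + 19"
    "s' p = c0" "s' (p + 1) = c1" "s' (p + 2) = c2" "s' (p + 3) = c3"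
    "s' (p + 4) = L" "s' (p + 5) = ka" "s' (p + 6) = 0"
    "s' (p + 7) = p + 3" "s' (p + 8) = ob" "s' (p + 9) = b"
    "s' (p + 10) = p + 2" "s' (p + 11) = off" "s' (p + 12) = a"
    "s' (p + 13) = p + 1" "s' (p + 14) = ob" "s' (p + 15) = b"
    "s' (p + 16) = p" "s' (p + 17) = off" "s' (p + 18) = a"
    and frame: "\<And>x. x \<noteq> 4 \<Longrightarrow> x < p \<Longrightarrow> s' x = s2 x"
    unfolding c by blast
  have fr: "s' x = s x" if "x < 4 \<or> 16 \<le> x" "x < p" "x \<noteq> L" for x
    using frame[of x] that by (auto simp: s2_def s1_def)
  have "s' L = i * D + s L mod D" using frame[of L] s2(11) Lk addr by simp
  moreover have "good s'"
    using s(1) s'M fr[of 0] fr[of 1] addr \<open>16 \<le> p\<close> by (auto simp: good_def)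
  moreover have "exec orc step_prog s = Some (1, s')"
    by (simp add: e1 expand_prog_def e2 ex)
  moreover have "same p {L} s s'" using fr by (simp add: same_def)
  ultimately show ?thesis
    using s' by (intro exI[of _ s']) (simp add: c ab ka_def power2_eq_square)
qed

end

section \<open>Digit strings as vertex numbers\<close>

fun num :: "nat \<Rightarrow> mem \<Rightarrow> nat \<Rightarrow> nat \<Rightarrow> nat" where
  "num B s off 0 = 0"
| "num B s off (Suc n) = enc B (num B s off n, s (off + n))"

text \<open>Concatenation is the pair encoding of \<open>tensor\<close>: the second factor has
  \<open>b\<close> digits, hence \<open>B ^ b\<close> vertices.\<close>

lemma num_add: "num B s off (a + b) = enc (B ^ b) (num B s off a, num B s (off + a) b)"
  by (induction b) (simp_all add: enc_def algebra_simps)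

lemma num_less:
  assumes "\<forall>i<n. s (off + i) < B"
  shows "num B s off n < B ^ n"
  using assms
proof (induction n)
  case (Suc n)
  then have "num B s off n < B ^ n" "s (off + n) < B" by simp_all
  from enc_less[OF this] show ?case by (simp add: mult.commute)
qed simp

lemma num_cong: "\<forall>i<n. s' (off + i) = s (off + i) \<Longrightarrow> num B s' off n = num B s off n"
  by (induction n) simp_all

text \<open>Follows one edge through the nested products. Cutting \<open>k\<close> first at the
  square and then at each tensor product yields its four digits in base \<open>D\<^sup>2\<close>,
  the form in which the machine handles labels.\<close>

lemma rot_zigzag_square_tensor:
  assumes "0 < D" "deg Ga = D\<^sup>2" "nv Gb = N" "deg Gb = D\<^sup>2" "deg H = D"
    and "k0 < D ^ 8" "vb < N" "vb1 < N"
    and "rot H (k0, e div D) = (k, i)"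
    and "rot Ga (va, k div D\<^sup>2 div D\<^sup>2 div D\<^sup>2) = (va1, c0)"
    and "rot Gb (vb, k div D\<^sup>2 div D\<^sup>2 mod D\<^sup>2) = (vb1, c1)"
    and "rot Ga (va1, k div D\<^sup>2 mod D\<^sup>2) = (va2, c2)"
    and "rot Gb (vb1, k mod D\<^sup>2) = (vb2, c3)"
    and "rot H (((c2 * D\<^sup>2 + c3) * D\<^sup>2 + c0) * D\<^sup>2 + c1, e mod D) = (l, j)"
  shows "rot (zigzag (square (tensor Ga Gb)) H) (enc (D ^ 8) (enc N (va, vb), k0), e)
    = (enc (D ^ 8) (enc N (va2, vb2), l), j * D + i)"
proof -
  define d where "d = D\<^sup>2"
  have d: "0 < d" using assms(1) by (simp add: d_def)
  have 8: "(d * d)\<^sup>2 = D ^ 8" unfolding d_def by (simp flip: power_add power_mult)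
  have digits: "k div (d * d) div d = k div d div d div d" "k div (d * d) mod d = k div d div d mod d"
    "k mod (d * d) div d = k div d mod d" "k mod (d * d) mod d = k mod d"
    using d by (simp_all add: div_mult2_eq mod_mult2_eq)
  have l': "enc (d * d) (enc d (c2, c3), enc d (c0, c1)) = ((c2 * d + c3) * d + c0) * d + c1"
    by (simp add: enc_def algebra_simps)
  have k: "dec (d * d) k = (k div (d * d), k mod (d * d))"
    "dec d (k div (d * d)) = (k div d div d div d, k div d div d mod d)"
    "dec d (k mod (d * d)) = (k div d mod d, k mod d)"
    "dec D e = (e div D, e mod D)"
    using digits by (simp_all add: dec_def)
  have "rot (square (tensor Ga Gb)) (enc N (va, vb), k)
      = (enc N (va2, vb2), ((c2 * d + c3) * d + c0) * d + c1)"
    using assms(2-14) k by (simp add: d_def[symmetric] l')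
  moreover have "deg (square (tensor Ga Gb)) = D ^ 8"
    using assms(2,4) 8 by (simp add: d_def)
  ultimately show ?thesis
    using assms(5-14) k(4) by (simp add: d_def[symmetric] del: square_sel tensor_sel) (simp add: enc_def)
qed

text \<open>By truncated subtraction this is nonzero exactly when the stack pointer exceeds
  \<open>16 + t\<close>, that is, while entries are pending.\<close>

definition main_cond :: expr where
  "main_cond = reg 4 \<ominus> (reg 0 \<oplus> Lit 16)"

context machine
begin

abbreviation "B \<equiv> D ^ 8"

section \<open>Correctness and cost of a call\<close>

lemma orc_bounded: "orc_bounded M orc"
proof -
  have "x \<le> M \<and> y \<le> M" if "orc z = Some (x, y)" for z x y
  proof -
    from that have "z \<in> rdom H" "rot H z = (x, y)"
      by (auto simp: rot_oracle_def restrict_map_def split: if_splits)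
    then show ?thesis
      using rot_less[of "fst z" "snd z" x y] le_M by (auto simp: rdom_def nvH degH)
  qed
  then show ?thesis by (auto simp: orc_bounded_def)
qed

text \<open>\<open>p\<close> is the stack pointer once the call is popped. The label lies below it
  and outside the digits, so the two never alias. A headroom of \<open>19 * n\<close> cells
  suffices, since an expansion occupies 19 cells and its subcalls have sizes below
  \<open>n\<close>.\<close>

definition call_pre :: "nat \<Rightarrow> nat \<Rightarrow> nat \<Rightarrow> nat \<Rightarrow> mem \<Rightarrow> bool" where
  "call_pre n off L p s \<longleftrightarrow> good s \<and> s 4 = p + 3 \<and> s p = L \<and> s (p + 1) = off \<and> s (p + 2) = n \<and>
     16 \<le> off \<and> off + n \<le> 16 + t \<and> 16 + t \<le> p \<and> p + 19 * n \<le> M \<and> (L = 3 \<or> 16 + t \<le> L) \<and> L < p \<and>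
     (\<forall>i<n. s (off + i) < B) \<and> s L < D\<^sup>2"

definition call_post :: "nat \<Rightarrow> nat \<Rightarrow> nat \<Rightarrow> nat \<Rightarrow> mem \<Rightarrow> mem \<Rightarrow> bool" where
  "call_post n off L p s s' \<longleftrightarrow> good s' \<and> s' 4 = p \<and>
     (num B s' off n, s' L) = rot (graph_seq H n) (num B s off n, s L) \<and>
     (\<forall>i<n. s' (off + i) < B) \<and> s' L < D\<^sup>2 \<and> same p ({L} \<union> {off..<off + n}) s s'"

lemma sameD: "same p X s s' \<Longrightarrow> x < 4 \<or> 16 \<le> x \<Longrightarrow> x < p \<Longrightarrow> x \<notin> X \<Longrightarrow> s' x = s x"
  unfolding same_def by blast

lemma call_1:
  assumes "call_pre 1 off L p s"
  shows "\<exists>s'. exec orc step_prog s = Some (2, s') \<and> call_post 1 off L p s s'"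
proof -
  note pre = assms[unfolded call_pre_def]
  obtain x1 l1 where r1: "rot H (s off, s L div D) = (x1, l1)" by fastforce
  obtain x2 l2 where r2: "rot H (x1, s L mod D) = (x2, l2)" by fastforce
  have off: "s off < B" and L: "s L < D\<^sup>2" using pre by auto
  note b1 = rot_less[OF off label_div_mod(1)[OF L] r1]
  note b2 = rot_less[OF b1(1) label_div_mod(2)[OF L] r2]
  have "off < p" "L = 3 \<or> 16 \<le> L" "L \<noteq> off" "p \<le> M" using pre by auto
  with exec_leaf1[where s = s and off = off and L = L and p = p, OF _ _ _ _ _ _ _ _ _ _ _ off L r1 r2] pre
  obtain s' where s': "exec orc step_prog s = Some (2, s')" "good s'" "s' 4 = p"
    "s' off = x2" "s' L = l2 * D + l1" "same p {L, off} s s'"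
    by blast
  have "rot (graph_seq H 1) (s off, s L) = (x2, l2 * D + l1)"
    using r1 r2 by (simp add: graph_seq_1 degH dec_def enc_def)
  moreover have "same p ({L} \<union> {off..<off + 1}) s s'"
    using s'(6) by (simp add: same_def)
  ultimately have "call_post 1 off L p s s'"
    using s' b1 b2 label_less[OF b2(2) b1(2)] by (simp add: call_post_def enc_def)
  then show ?thesis using s'(1) by blast
qed

lemma call_2:
  assumes "call_pre 2 off L p s"
  shows "\<exists>s'. exec orc step_prog s = Some (2, s') \<and> call_post 2 off L p s s'"
proof -
  note pre = assms[unfolded call_pre_def]
  obtain x1 l1 where r1: "rot H (s off, s L div D) = (x1, l1)" by fastforce
  obtain x2 l2 where r2: "rot H (s (off + 1), s L mod D) = (x2, l2)" by fastforce
  have off: "s off < B" "s (off + 1) < B" and L: "s L < D\<^sup>2" using pre by (auto simp: numeral_2_eq_2 All_less_Suc2)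
  note b1 = rot_less[OF off(1) label_div_mod(1)[OF L] r1]
  note b2 = rot_less[OF off(2) label_div_mod(2)[OF L] r2]
  have "off + 1 < p" "L = 3 \<or> 16 \<le> L" "L \<noteq> off" "L \<noteq> off + 1" "p \<le> M" using pre by auto
  with exec_leaf2[where s = s and off = off and L = L and p = p, OF _ _ _ _ _ _ _ _ _ _ _ _ off L r1 r2] pre
  obtain s' where s': "exec orc step_prog s = Some (2, s')" "good s'" "s' 4 = p"
    "s' off = x1" "s' (off + 1) = x2" "s' L = l1 * D + l2" "same p {L, off, off + 1} s s'"
    by blast
  have num2: "num B r off 2 = enc B (r off, r (off + 1))" for r
    by (simp add: numeral_2_eq_2 enc_def)
  have "rot (graph_seq H 2) (num B s off 2, s L) = (enc B (x1, x2), l1 * D + l2)"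
    unfolding num2 using r1 r2 off by (simp add: graph_seq_2 degH nvH) (simp add: dec_def enc_def)
  moreover have "{L} \<union> {off..<off + 2} = {L, off, off + 1}" by auto
  then have "same p ({L} \<union> {off..<off + 2}) s s'"
    using s'(7) by (simp only:)
  moreover have "\<forall>i<2. s' (off + i) < B"
    using s'(4,5) b1 b2 by (auto simp: less_2_cases_iff)
  ultimately have "call_post 2 off L p s s'"
    using s' label_less[OF b1(2) b2(2)] by (simp add: call_post_def num2)
  then show ?thesis using s'(1) by blast
qed


lemma call_preI:
  assumes "good s" "s 4 = p + (k + 3)" "s (p + k) = L" "s (p + (k + 1)) = off" "s (p + (k + 2)) = n"
    and "16 \<le> off" "off + n \<le> 16 + t" "16 + t \<le> p" "p + (k + 19 * n) \<le> M"
    and "L = 3 \<or> 16 + t \<le> L" "L < p + k" "\<And>i. i < n \<Longrightarrow> s (off + i) < B" "s L < D\<^sup>2"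
  shows "call_pre n off L (p + k) s"
  using assms by (simp add: call_pre_def add.assoc)

text \<open>
  The relation \<open>R\<close> stands for reaching a state at a given cost; it is kept abstract because the cost
  plays no role in the correctness of the recursion.
\<close>

lemma call_ge_3:
  assumes pre: "call_pre n off L p s" and n: "3 \<le> n"
    and IHa: "\<And>L p s. call_pre (n div 2) off L p s \<Longrightarrow>
      \<exists>s'. R s ca s' \<and> call_post (n div 2) off L p s s'"
    and IHb: "\<And>L p s. call_pre ((n - 1) div 2) (off + n div 2) L p s \<Longrightarrow>
      \<exists>s'. R s cb s' \<and> call_post ((n - 1) div 2) (off + n div 2) L p s s'"
  shows "\<exists>s0 s1 s2 s3 s4 s5. exec orc step_prog s = Some (1, s0) \<and> good s0 \<and> 
    R s0 ca s1 \<and> R s1 cb s2 \<and> R s2 ca s3 \<and> R s3 cb s4 \<and>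
    good s4 \<and> 16 + t < s4 4 \<and> exec orc step_prog s4 = Some (1, s5) \<and> call_post n off L p s s5"
proof -
  define a b ob ka where ab: "a = n div 2" "b = (n - 1) div 2" "ob = off + a" "ka = off + n - 1"
  have nab: "n = a + b + 1" "1 \<le> a" "1 \<le> b" "a \<le> n - 1" "b \<le> n - 1"
    using n halves_sum[OF n] by (auto simp: ab)
  have ob_ka: "ka = off + (a + b)" "ka = ob + b" using nab by (simp_all add: ab(3,4))
  note pre' = pre[unfolded call_pre_def]
  have "\<forall>i<n. s (off + i) < B" and L: "s L < D\<^sup>2" using pre' by simp_all
  from this(1)[rule_format, of "n - 1"] have ka: "s ka < B" using n by (simp add: ab(4))
  obtain k i where r1: "rot H (s ka, s L div D) = (k, i)" by fastforce
  note b1 = rot_less[OF ka label_div_mod(1)[OF L] r1]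
  have pM: "p + 19 * n \<le> M" and p: "16 + t \<le> p" "off + n \<le> 16 + t" "16 \<le> off" "L < p" "L = 3 \<or> 16 + t \<le> L"
    using pre' by auto
  have L': "L = 3 \<or> 16 \<le> L" "L < off \<or> off + n \<le> L" "off + n \<le> p" "p + 19 \<le> M" using p pM n by auto
  obtain s0 where s0: "exec orc step_prog s = Some (1, s0)" "good s0" "s0 4 = p + 19"
    "s0 L = i * D + s L mod D" "same p {L} s s0"
    "s0 p = k div D\<^sup>2 div D\<^sup>2 div D\<^sup>2" "s0 (p + 1) = k div D\<^sup>2 div D\<^sup>2 mod D\<^sup>2"
    "s0 (p + 2) = k div D\<^sup>2 mod D\<^sup>2" "s0 (p + 3) = k mod D\<^sup>2"
    "s0 (p + 4) = L" "s0 (p + 5) = ka" "s0 (p + 6) = 0"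
    "s0 (p + 7) = p + 3" "s0 (p + 8) = ob" "s0 (p + 9) = b"
    "s0 (p + 10) = p + 2" "s0 (p + 11) = off" "s0 (p + 12) = a"
    "s0 (p + 13) = p + 1" "s0 (p + 14) = ob" "s0 (p + 15) = b"
    "s0 (p + 16) = p" "s0 (p + 17) = off" "s0 (p + 18) = a"
    using exec_expand[where s = s and p = p and L = L and off = off and n = n and k = k and i = i,
        folded ab, OF _ _ _ _ _ n p(3) L'(3,1) p(4) L'(2,4) ka L r1] pre'
    by blast
  \<comment> \<open>Only the leading digit depends on the size of \<open>k\<close>; the others are
    remainders.\<close>
  have dig: "s0 p < D\<^sup>2" "s0 (p + 1) < D\<^sup>2" "s0 (p + 2) < D\<^sup>2" "s0 (p + 3) < D\<^sup>2"
  proof -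
    have "D ^ 8 = D\<^sup>2 * (D\<^sup>2 * (D\<^sup>2 * D\<^sup>2))" by (simp flip: power_add)
    then have "k < D\<^sup>2 * D\<^sup>2 * D\<^sup>2 * D\<^sup>2" using b1(1) by (simp add: mult.assoc)
    then show "s0 p < D\<^sup>2" using s0(6) by (simp add: less_mult_imp_div_less)
  qed (use s0(7-9) D1 in simp_all)
  have sM: "p + 16 + 19 * a \<le> M" "p + 16 + 19 * b \<le> M" using pM nab by linarith+
  have d0: "s0 (off + j) = s (off + j)" if "j < n" for j
    using that p L' by (intro sameD[OF s0(5)]) auto
  have digs: "s (off + j) < B" if "j < n" for j using pre' that by simp
  \<comment> \<open>The four calls sit at \<open>p + 16\<close>, \<open>p + 13\<close>,
    \<open>p + 10\<close> and \<open>p + 7\<close>, with label cells \<open>p\<close> to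
    \<open>p + 3\<close> in this order.\<close>
  have p0: "call_pre a off p (p + 16) s0"
    using s0(2,3,22-24) dig(1) sM(1) p nab(1) d0 digs by (intro call_preI) simp_all
  obtain s1 where s1: "R s0 ca s1" "call_post a off p (p + 16) s0 s1"
    using IHa[folded ab, OF p0] by blast
  note q1 = s1(2)[unfolded call_post_def]
  have g1: "good s1" "s1 4 = p + 16" using q1 by simp_all
  \<comment> \<open>Apart from scratch registers, a subcall alters below its entry only its label
    cell and its own half of the digits; the cloud digit \<open>ka\<close> belongs to neither
    half.\<close>
  have f1: "s1 x = s0 x" if "x < 4 \<or> 16 \<le> x" "x < p + 16" "x \<noteq> p" "x < off \<or> ob \<le> x" for x
    by (rule sameD[where x = x and s = s0 and s' = s1 and p = "p + 16" and X = "{p} \<union> {off..<off + a}"]) (use that q1 in \<open>auto simp: ab\<close>)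
  have h1: "s1 (p + j) = s0 (p + j)" if "j \<noteq> 0" "j < 16" for j
    using f1[of "p + j"] that p nab(1) ob_ka(1) by (simp add: ab(3))
  have p1: "call_pre b ob (p + 1) (p + 13) s1"
  proof -
    have "s1 (ob + j) = s0 (ob + j)" if "j < b" for j
      using that p nab L' by (intro f1) (auto simp: ab(3))
    moreover have "s0 (ob + j) < B" if "j < b" for j
      using d0[of "a + j"] digs[of "a + j"] that nab by (simp add: ab(3) add.assoc)
    moreover have cells: "s1 (p + 1) < D\<^sup>2" "s1 (p + 13) = p + 1" "s1 (p + 14) = ob" "s1 (p + 15) = b"
      using h1[of 1] h1[of 13]
        h1[of 14] h1[of 15] dig s0(19-21)
      by simp_all
    ultimately show ?thesis
      using g1 sM p nab ab(3) by (intro call_preI) simp_all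
  qed
  obtain s2 where s2: "R s1 cb s2" "call_post b ob (p + 1) (p + 13) s1 s2"
    using IHb[folded ab, OF p1] by blast
  note q2 = s2(2)[unfolded call_post_def]
  have g2: "good s2" "s2 4 = p + 13" using q2 by simp_all
  have f2: "s2 x = s1 x" if "x < 4 \<or> 16 \<le> x" "x < p + 13" "x \<noteq> p + 1" "x < ob \<or> ka \<le> x" for x
    by (rule sameD[where x = x and s = s1 and s' = s2 and p = "p + 13" and X = "{p + 1} \<union> {ob..<ob + b}"]) (use that q2 in \<open>auto simp: ob_ka(2)\<close>)
  have h2: "s2 (p + j) = s1 (p + j)" if "j \<noteq> 1" "j < 13" for j
    using f2[of "p + j"] that p nab(1) ob_ka(1) by (simp add: ab(3))
  have p2: "call_pre a off (p + 2) (p + 10) s2"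
  proof -
    have "s2 (off + j) = s1 (off + j)" if "j < a" for j
      using that p nab L' by (intro f2) (auto simp: ab(3))
    moreover have "s1 (off + j) < B" if "j < a" for j
      using q1 that by simp
    moreover have cells: "s2 (p + 2) < D\<^sup>2" "s2 (p + 10) = p + 2" "s2 (p + 11) = off" "s2 (p + 12) = a"
      using h1[of 2] h2[of 2] h1[of 10] h2[of 10]
        h1[of 11] h2[of 11] h1[of 12] h2[of 12] dig s0(16-18)
      by simp_all
    ultimately show ?thesis
      using g2 sM p nab ab(3) by (intro call_preI) simp_all
  qed
  obtain s3 where s3: "R s2 ca s3" "call_post a off (p + 2) (p + 10) s2 s3"
    using IHa[folded ab, OF p2] by blast
  note q3 = s3(2)[unfolded call_post_def]
  have g3: "good s3" "s3 4 = p + 10" using q3 by simp_all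
  have f3: "s3 x = s2 x" if "x < 4 \<or> 16 \<le> x" "x < p + 10" "x \<noteq> p + 2" "x < off \<or> ob \<le> x" for x
    by (rule sameD[where x = x and s = s2 and s' = s3 and p = "p + 10" and X = "{p + 2} \<union> {off..<off + a}"]) (use that q3 in \<open>auto simp: ab\<close>)
  have h3: "s3 (p + j) = s2 (p + j)" if "j \<noteq> 2" "j < 10" for j
    using f3[of "p + j"] that p nab(1) ob_ka(1) by (simp add: ab(3))
  have p3: "call_pre b ob (p + 3) (p + 7) s3"
  proof -
    have "s3 (ob + j) = s2 (ob + j)" if "j < b" for j
      using that p nab L' by (intro f3) (auto simp: ab(3))
    moreover have "s2 (ob + j) < B" if "j < b" for j
      using q2 that by simp
    moreover have cells: "s3 (p + 3) < D\<^sup>2" "s3 (p + 7) = p + 3" "s3 (p + 8) = ob" "s3 (p + 9) = b"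
      using h1[of 3] h2[of 3] h3[of 3] h1[of 7] h2[of 7] h3[of 7]
        h1[of 8] h2[of 8] h3[of 8] h1[of 9] h2[of 9] h3[of 9] dig s0(13-15)
      by simp_all
    ultimately show ?thesis
      using g3 sM p nab ab(3) by (intro call_preI) simp_all
  qed
  obtain s4 where s4: "R s3 cb s4" "call_post b ob (p + 3) (p + 7) s3 s4"
    using IHb[folded ab, OF p3] by blast
  note q4 = s4(2)[unfolded call_post_def]
  have g4: "good s4" "s4 4 = p + 7" using q4 by simp_all
  have f4: "s4 x = s3 x" if "x < 4 \<or> 16 \<le> x" "x < p + 7" "x \<noteq> p + 3" "x < ob \<or> ka \<le> x" for x
    by (rule sameD[where x = x and s = s3 and s' = s4 and p = "p + 7" and X = "{p + 3} \<union> {ob..<ob + b}"]) (use that q4 in \<open>auto simp: ob_ka(2)\<close>)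
  have h4: "s4 (p + j) = s3 (p + j)" if "j \<noteq> 3" "j < 7" for j
    using f4[of "p + j"] that p nab(1) ob_ka(1) by (simp add: ab(3))
  \<comment> \<open>No subcall touches \<open>L\<close>, so the new first half and the old second
    half survive until the closing query.\<close>
  have L0: "s4 L = i * D + s L mod D"
    using f1[of L] f2[of L] f3[of L] f4[of L] s0(4) p L' nab ob_ka by (auto simp: ab(3))
  have i: "s4 L div D = i" "s4 L mod D = s L mod D" "s4 L < D\<^sup>2"
    using label_div_mod(2)[OF L] D1 label_less[OF b1(2) label_div_mod(2)[OF L]] by (simp_all add: L0)
  have c: "s4 p = s1 p" "s4 (p + 1) = s2 (p + 1)" "s4 (p + 2) = s3 (p + 2)"
    using h2[of 0] h3[of 0] h4[of 0] h3[of 1] h4[of 1] h4[of 2] by simp_all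
  have frame: "s4 (p + 4) = L" "s4 (p + 5) = ka" "s4 (p + 6) = 0"
    by (simp_all add: h1 h2 h3 h4 s0(10-12))
  have c1: "s1 (p + 1) = s0 (p + 1)" "s2 (p + 2) = s0 (p + 2)" "s3 (p + 3) = s0 (p + 3)"
    using h1[of 1] h1[of 2] h2[of 2] by (simp_all add: h1 h2 h3)
  define l' where "l' = ((s4 (p + 2) * D\<^sup>2 + s4 (p + 3)) * D\<^sup>2 + s4 p) * D\<^sup>2 + s4 (p + 1)"
  have l': "l' < B"
  proof -
    have d: "s4 (p + 2) < D\<^sup>2" "s4 (p + 3) < D\<^sup>2" "s4 p < D\<^sup>2" "s4 (p + 1) < D\<^sup>2"
      using q1 q2 q3 q4 c by simp_all
    have "l' < D\<^sup>2 * D\<^sup>2 * D\<^sup>2 * D\<^sup>2"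
      unfolding l'_def by (intro enc_less[unfolded enc_def prod.case] d)
    then show ?thesis by (simp flip: power_add)
  qed
  obtain l j where r2: "rot H (l', s4 L mod D) = (l, j)" by fastforce
  note b2 = rot_less[OF l' label_div_mod(2)[OF i(3)] r2]
  have k4: "16 \<le> ka" "ka < p" "L \<noteq> ka" "p \<le> M" using p L' n by (auto simp: ab(4))
  obtain s5 where s5: "exec orc step_prog s4 = Some (1, s5)" "good s5" "s5 4 = p"
    "s5 ka = l" "s5 L = j * D + i" "same p {L, ka} s4 s5"
    using exec_finish[where s = s4 and p = p and L = L and ka = ka and l = l and j = j, folded l'_def,
        OF g4 frame k4(1,2) L'(1) p(4) k4(3,4) l' i(3) r2] i(1) by metis
  have f5: "s5 x = s4 x" if "x < 4 \<or> 16 \<le> x" "x < p" "x \<noteq> L" "x \<noteq> ka" for x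
    using that by (intro sameD[OF s5(6)]) auto
  have digits_a: "s1 (off + j) = s2 (off + j)" "s3 (off + j) = s4 (off + j)" "s4 (off + j) = s5 (off + j)" if "j < a" for j
    using f2[of "off + j"] f4[of "off + j"] f5[of "off + j"] that p nab L' ob_ka by (auto simp: ab(3))
  have digits_b: "s (ob + j) = s1 (ob + j)" "s2 (ob + j) = s3 (ob + j)" "s4 (ob + j) = s5 (ob + j)" if "j < b" for j
    using d0[of "a + j"] f1[of "ob + j"] f3[of "ob + j"] f5[of "ob + j"] that p nab L' ob_ka
    by (auto simp: ab(3) add.assoc)
  have num_a: "num B s0 off a = num B s off a" "num B s2 off a = num B s1 off a" "num B s5 off a = num B s3 off a"
    using d0 digits_a nab by (auto intro!: num_cong)
  have num_b: "num B s1 ob b = num B s ob b" "num B s3 ob b = num B s2 ob b" "num B s5 ob b = num B s4 ob b"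
    using digits_b by (auto intro!: num_cong)
  \<comment> \<open>The string splits like a zig-zag vertex: a pair of factor vertices, then the
    cloud position.\<close>
  have num_n: "num B r off n = enc B (enc (B ^ b) (num B r off a, num B r ob b), r ka)" for r
    unfolding nab(1) ob_ka(1) by (simp add: num_add[of B r off a b] ab(3))
  have reg_seq: "deg (graph_seq H a) = D\<^sup>2" "nv (graph_seq H b) = B ^ b" "deg (graph_seq H b) = D\<^sup>2"
    using graph_seq_regular[OF reg nvH degH] nab by (simp_all add: power_mult)
  have digits_ob: "s (ob + j) < B" "s2 (ob + j) < B" if "j < b" for j
    using digs[of "a + j"] q2 that nab by (simp_all add: ab(3) add.assoc)
  have "rot (graph_seq H n) (num B s off n, s L) = (num B s5 off n, s5 L)"
    unfolding num_n num_a num_b graph_seq_ge_3[OF n, folded ab] s5(4,5)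
  proof (rule rot_zigzag_square_tensor[OF _ reg_seq degH ka _ _ r1])
    show "0 < D" using D1 by simp
    show "num B s ob b < B ^ b" "num B s2 ob b < B ^ b" using digits_ob by (auto intro: num_less)
    show "rot (graph_seq H a) (num B s off a, k div D\<^sup>2 div D\<^sup>2 div D\<^sup>2) = (num B s1 off a, s1 p)"
      using q1 s0(6) num_a by simp
    show "rot (graph_seq H b) (num B s ob b, k div D\<^sup>2 div D\<^sup>2 mod D\<^sup>2) = (num B s2 ob b, s2 (p + 1))"
      using q2 s0(7) num_b c1 by simp
    show "rot (graph_seq H a) (num B s1 off a, k div D\<^sup>2 mod D\<^sup>2) = (num B s3 off a, s3 (p + 2))"
      using q3 s0(8) num_a c1 by simp
    show "rot (graph_seq H b) (num B s2 ob b, k mod D\<^sup>2) = (num B s4 ob b, s4 (p + 3))"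
      using q4 s0(9) num_b c1 by simp
    show "rot H (((s3 (p + 2) * D\<^sup>2 + s4 (p + 3)) * D\<^sup>2 + s1 p) * D\<^sup>2 + s2 (p + 1), s L mod D) = (l, j)"
      using r2 i c by (simp add: l'_def)
  qed
  moreover have "s5 (off + j) < B" if "j < n" for j
  proof -
    consider "j < a" | "a \<le> j" "j < a + b" | "j = a + b" using \<open>j < n\<close> nab(1) by linarith
    then show ?thesis
    proof cases
      case 1
      then have "s3 (off + j) < B" using q3 by blast
      then show ?thesis using digits_a(2,3)[OF 1] by simp
    next
      case 2
      then have "j - a < b" by linarith
      moreover from this have "s4 (ob + (j - a)) < B" using q4 by blast
      ultimately show ?thesis using digits_b(3)[of "j - a"] 2 by (simp add: ab(3))
    next
      case 3
      then show ?thesis using s5(4) b2(1) ob_ka(1) by simp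
    qed
  qed
  moreover have "same p ({L} \<union> {off..<off + n}) s s5"
    unfolding same_def
  proof (intro allI impI)
    fix x assume x: "x < 4 \<or> 16 \<le> x" "x < p" "x \<notin> {L} \<union> {off..<off + n}"
    then have x': "x \<noteq> ka" "x < off \<or> ob \<le> x" "x < ob \<or> ka \<le> x" using nab ob_ka by (auto simp: ab(3))
    have "s0 x = s x" using x by (intro sameD[OF s0(5)]) auto
    then show "s5 x = s x" using f1[of x] f2[of x] f3[of x] f4[of x] f5[of x] x x' by simp
  qed
  ultimately have "call_post n off L p s s5"
    using s5 label_less[OF b2(2) b1(2)] by (simp add: call_post_def)
  moreover have "16 + t < s4 4" using g4(2) p(1) by simp
  ultimately show ?thesis using s0(1,2) s1(1) s2(1) s3(1) s4(1) g4(1) s5(1) by blast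
qed

text \<open>A call of size at least 3 spends two iterations of its own, expansion and completion,
  and calls each half twice; the quadratic weight absorbs this.\<close>

lemma graph_seq_weight:
  fixes n :: nat
  assumes "3 \<le> n"
  shows "2 + 2 * (2 * (n div 2)\<^sup>2) + 2 * (2 * ((n - 1) div 2)\<^sup>2) \<le> 2 * n\<^sup>2"
proof (cases "even n")
  case True
  then obtain k where "n = 2 * k" by blast
  moreover from this obtain j where "k = Suc j" using assms by (cases k) auto
  ultimately show ?thesis by (simp add: power2_eq_square algebra_simps)
next
  case False
  then obtain k where "n = 2 * k + 1" by (rule oddE)
  then show ?thesis by (simp add: power2_eq_square algebra_simps)
qed

text \<open>The same weight bounds iterations and queries: a leaf takes one iteration with two
  queries, an expansion and its completion one iteration with one query each.\<close>

lemma call_reach: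
  assumes K: "loop_bounded K main_cond step_prog" and "1 \<le> n" "call_pre n off L p s"
  shows "\<exists>s'. reach orc (Loop main_cond step_prog) s (2 * n\<^sup>2 * (K * bits M)) (2 * n\<^sup>2) s' \<and>
    call_post n off L p s s'"
  using assms(2,3)
proof (induction n arbitrary: off L p s rule: graph_seq_induct)
  let ?c = "K * bits M"
  have step: "reach orc (Loop main_cond step_prog) s ?c q s'"
    if "good s" "16 + t < s 4" "exec orc step_prog s = Some (q, s')" for s q s'
    using K M orc_bounded that unfolding loop_bounded_def good_def main_cond_def by simp
  {
    case 1
    then have "good s" "16 + t < s 4" by (simp_all add: call_pre_def)
    moreover from call_1[OF 1] obtain s' where "exec orc step_prog s = Some (2, s')" "call_post 1 off L p s s'"
      by blast
    ultimately show ?case using reach_mono[OF step, of s 2 s' "2 * 1\<^sup>2 * ?c" "2 * 1\<^sup>2"] by auto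
  next
    case 2
    then have "good s" "16 + t < s 4" by (simp_all add: call_pre_def)
    moreover from call_2[OF 2] obtain s' where "exec orc step_prog s = Some (2, s')" "call_post 2 off L p s s'"
      by blast
    ultimately show ?case using reach_mono[OF step, of s 2 s' "2 * 2\<^sup>2 * ?c" "2 * 2\<^sup>2"] by auto
  next
    case (ge_3 n)
    define w where "w = (\<lambda>n :: nat. 2 * n\<^sup>2)"
    define R where "R = (\<lambda>s w s'. reach orc (Loop main_cond step_prog) s (w * ?c) w s')"
    from call_ge_3[where R = R and ca = "w (n div 2)" and cb = "w ((n - 1) div 2)", OF ge_3(4,1)]
    obtain s0 s1 s2 s3 s4 s5 where s: "exec orc step_prog s = Some (1, s0)"
      "R s0 (w (n div 2)) s1" "R s1 (w ((n - 1) div 2)) s2" "R s2 (w (n div 2)) s3"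
      "R s3 (w ((n - 1) div 2)) s4" "good s4" "16 + t < s4 4" "exec orc step_prog s4 = Some (1, s5)"
      "call_post n off L p s s5"
      using ge_3(2,3) unfolding R_def w_def by blast
    have "good s" "16 + t < s 4" using ge_3(4) by (simp_all add: call_pre_def)
    from step[OF this s(1)] step[OF s(6-8)] have ends: "R s 1 s0" "R s4 1 s5" by (simp_all add: R_def)
    have trans: "R r (u + v) r''" if "R r u r'" "R r' v r''" for r r' r'' u v
      using reach_trans that unfolding R_def add_mult_distrib by blast
    have "R s (1 + (w (n div 2) + (w ((n - 1) div 2) + (w (n div 2) + (w ((n - 1) div 2) + 1))))) s5"
      by (rule trans[OF ends(1) trans[OF s(2) trans[OF s(3) trans[OF s(4) trans[OF s(5) ends(2)]]]]])
    moreover have "1 + (w (n div 2) + (w ((n - 1) div 2) + (w (n div 2) + (w ((n - 1) div 2) + 1)))) \<le> w n"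
      using graph_seq_weight[OF ge_3(1)] by (simp add: w_def)
    ultimately have "R s (w n) s5"
      unfolding R_def by (meson reach_mono mult_le_mono1)
    then show ?case using s(9) by (auto simp: R_def w_def)
  }
qed

end

section \<open>The main program\<close>

definition base_prog :: prog where
  "base_prog = block
    [set_reg 8 (reg 1 \<otimes> reg 1), set_reg 8 (reg 8 \<otimes> reg 8), set_reg 8 (reg 8 \<otimes> reg 8)]"

text \<open>Register 9 counts down from \<open>t\<close> to 1, and the offset 15 sends the digit
  split off at count j to cell 15 + j. The least significant digit comes first and thus lands in the
  last cell.\<close>

definition split_prog :: prog where
  "split_prog = block
    [Store (Lit 15 \<oplus> reg 9) (reg 2 \<odot> reg 8), set_reg 2 (reg 2 \<oslash> reg 8), set_reg 9 (reg 9 \<ominus> Lit 1)]"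

definition start_prog :: prog where
  "start_prog = block
    [Store (reg 0 \<oplus> Lit 16) (Lit 3), Store (reg 0 \<oplus> Lit 17) (Lit 16), Store (reg 0 \<oplus> Lit 18) (reg 0),
     set_reg 4 (reg 0 \<oplus> Lit 19)]"

definition join_prog :: prog where
  "join_prog = block
    [set_reg 2 (reg 2 \<otimes> reg 8 \<oplus> Cell (Lit 16 \<oplus> reg 9)), set_reg 9 (reg 9 \<oplus> Lit 1)]"

definition init_prog :: prog where
  "init_prog = Seq base_prog (set_reg 9 (reg 0))"

definition collect_prog :: prog where
  "collect_prog = Seq base_prog (block [set_reg 2 (Lit 0), set_reg 9 (Lit 0)])"

definition output_prog :: prog where
  "output_prog = block [set_reg 0 (reg 2), set_reg 1 (reg 3)]"

definition rot_prog :: prog where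
  "rot_prog = Seq init_prog (Seq (Loop (reg 9) split_prog) (Seq start_prog
    (Seq (Loop main_cond step_prog) (Seq collect_prog
      (Seq (Loop (reg 0 \<ominus> reg 9) join_prog) output_prog)))))"

text \<open>Upper bounds replace the exact counts of \<open>run\<close>, so that estimates for
  consecutive phases simply add up.\<close>

definition halts ::
  "(nat \<times> nat \<rightharpoonup> nat \<times> nat) \<Rightarrow> prog \<Rightarrow> mem \<Rightarrow> nat \<Rightarrow> nat \<Rightarrow> mem \<Rightarrow> bool" where
  "halts orc p s c q s' \<longleftrightarrow> (\<exists>T\<le>c. \<exists>Q\<le>q. run orc p s T Q s')"

lemma halts_Seq:
  assumes "halts orc p s c q s'" "halts orc p' s' c' q' s''"
  shows "halts orc (Seq p p') s (c + c' + 1) (q + q') s''"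
proof -
  from assms obtain T Q T' Q' where "T \<le> c" "Q \<le> q" "run orc p s T Q s'"
    and "T' \<le> c'" "Q' \<le> q'" "run orc p' s' T' Q' s''"
    unfolding halts_def by blast
  then show ?thesis using run.Seq[of orc p s T Q s' p' T' Q' s'']
    unfolding halts_def by (intro exI[of _ "T + T' + 1"] exI[of _ "Q + Q'"] conjI) auto
qed

lemma halts_mono:
  assumes "halts orc p s c q s'" "c \<le> c'" "q \<le> q'"
  shows "halts orc p s c' q' s'"
  using assms unfolding halts_def by (meson order_trans)

context machine
begin

lemma M2: "2 \<le> M"
  using M by simp

lemma halts_exec:
  assumes "exec_bounded K p" "good s" "exec orc p s = Some (q, s')"
  shows "halts orc p s (K * bits M) q s'"
proof -
  have "\<forall>x. s x \<le> M" using assms(2) by (simp add: good_def)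
  then obtain T where "T \<le> K * bits M" "run orc p s T q s'"
    by (rule exec_boundedD[OF assms(1) M2 _ orc_bounded assms(3)])
  then show ?thesis unfolding halts_def by blast
qed

lemma halts_Loop:
  assumes K: "loop_bounded K e p" and r: "reach orc (Loop e p) s c q s'" and s': "good s'" "val s' e = 0"
  shows "halts orc (Loop e p) s (K * bits M + c) q s'"
proof -
  have "\<forall>x. s' x \<le> M" using s'(1) by (simp add: good_def)
  then obtain T where T: "T \<le> K * bits M" "run orc (Loop e p) s' T 0 s'"
    using K M2 orc_bounded s'(2) unfolding loop_bounded_def by blast
  from r T(2) obtain T' Q' where "T' \<le> T + c" "Q' \<le> 0 + q" "run orc (Loop e p) s T' Q' s'"
    unfolding reach_def by blast
  then show ?thesis using T(1) unfolding halts_def by (intro exI[of _ T'] exI[of _ Q'] conjI) auto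
qed

lemma reach_Loop:
  assumes "loop_bounded K e p" "good s" "val s e \<noteq> 0" "exec orc p s = Some (q, s')"
  shows "reach orc (Loop e p) s (K * bits M) q s'"
proof -
  have "\<forall>x. s x \<le> M" using assms(2) by (simp add: good_def)
  then show ?thesis using assms M2 orc_bounded unfolding loop_bounded_def by blast
qed

text \<open>The remaining number is below \<open>B ^ j\<close>, so \<open>j\<close> divisions
  exhaust it and the digits written spell the original number.\<close>

lemma split_reach:
  assumes K: "loop_bounded K (reg 9) split_prog"
    and "good s" "s 8 = B" "s 9 = j" "s 2 < B ^ j"
  shows "\<exists>s'. reach orc (Loop (reg 9) split_prog) s (j * (K * bits M)) 0 s' \<and> good s' \<and> s' 9 = 0 \<and>
    num B s' 16 j = s 2 \<and> (\<forall>i<j. s' (16 + i) < B) \<and> s' 3 = s 3 \<and>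
    (\<forall>x. 16 + j \<le> x \<longrightarrow> s' x = s x)"
  using assms(2-)
proof (induction j arbitrary: s)
  case 0
  then show ?case using reach_refl by (intro exI[of _ s]) auto
next
  case (Suc j)
  define s1 where "s1 = s(16 + j := s 2 mod B, 2 := s 2 div B, 9 := j)"
  have B: "0 < B" using D1 by simp
  have ex: "exec orc split_prog s = Some (0, s1)"
    using Suc.prems(2,3) by (simp add: split_prog_def s1_def)
  have sM: "s x \<le> M" for x using Suc.prems(1) by (simp add: good_def)
  have "s 9 \<le> M" "s 2 \<le> M" using sM by blast+
  then have "j \<le> M" "s 2 mod B \<le> M" "s 2 div B \<le> M" using Suc.prems(3)
    by (auto intro: order_trans[OF div_le_dividend] order_trans[OF mod_less_eq_dividend])
  then have g1: "good s1" using Suc.prems(1) sM by (auto simp: good_def s1_def)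
  have "s 2 div B < B ^ j"
    using Suc.prems(4) by (intro less_mult_imp_div_less) (simp add: mult.commute)
  then have "s1 8 = B" "s1 9 = j" "s1 2 < B ^ j" using Suc.prems(2) by (simp_all add: s1_def)
  from Suc.IH[OF g1 this] obtain s' where s': "reach orc (Loop (reg 9) split_prog) s1 (j * (K * bits M)) 0 s'"
    "good s'" "s' 9 = 0" "num B s' 16 j = s1 2" "\<forall>i<j. s' (16 + i) < B" "s' 3 = s1 3"
    "\<forall>x. 16 + j \<le> x \<longrightarrow> s' x = s1 x"
    by blast
  have "val s (reg 9) \<noteq> 0" using Suc.prems(3) by simp
  from reach_trans[OF reach_Loop[OF K Suc.prems(1) this ex] s'(1)]
  have "reach orc (Loop (reg 9) split_prog) s (Suc j * (K * bits M)) 0 s'" by simp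
  moreover have d: "s' (16 + j) = s 2 mod B" using s'(7) by (simp add: s1_def)
  have "num B s' 16 j = s 2 div B" using s'(4) by (simp add: s1_def)
  then have "num B s' 16 (Suc j) = s 2"
    by (simp only: num.simps d enc_def prod.case div_mult_mod_eq)
  moreover have "\<forall>i<Suc j. s' (16 + i) < B"
    using s'(5) d B by (simp add: less_Suc_eq)
  ultimately show ?case using s' by (intro exI[of _ s']) (simp add: s1_def)
qed

text \<open>Horner's rule: register 9 tells how many digits are absorbed, \<open>j\<close> how many
  remain. Partial values stay below \<open>B ^ t\<close>, hence within \<open>M\<close>.\<close>

lemma join_reach:
  assumes K: "loop_bounded K (reg 0 \<ominus> reg 9) join_prog"
    and "good s" "s 8 = B" "s 9 + j = t" "s 2 = num B s 16 (s 9)" and "\<forall>i<t. s (16 + i) < B" and "B ^ t \<le> M"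
  shows "\<exists>s'. reach orc (Loop (reg 0 \<ominus> reg 9) join_prog) s (j * (K * bits M)) 0 s' \<and> good s' \<and> s' 9 = t \<and>
    s' 2 = num B s 16 t \<and> s' 3 = s 3"
  using assms(2-6)
proof (induction j arbitrary: s)
  case 0
  then show ?case using reach_refl by (intro exI[of _ s]) auto
next
  case (Suc j)
  define n where "n = s 9"
  define s1 where "s1 = s(2 := num B s 16 (Suc n), 9 := Suc n)"
  have nt: "Suc n \<le> t" using Suc.prems(3) by (simp add: n_def)
  have ex: "exec orc join_prog s = Some (0, s1)"
    using Suc.prems(2,4) by (simp add: join_prog_def s1_def enc_def n_def)
  have same: "num B s1 16 k = num B s 16 k" for k
    by (rule num_cong) (simp add: s1_def)
  have "num B s 16 (Suc n) < B ^ Suc n" using Suc.prems(5) nt by (intro num_less) auto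
  also have "\<dots> \<le> B ^ t" using nt D1 by (intro power_increasing) auto
  also have "\<dots> \<le> M" by (rule assms)
  finally have g1: "good s1" using Suc.prems(1) nt M by (auto simp: good_def s1_def)
  have "s1 8 = B" "s1 9 + j = t" "s1 2 = num B s1 16 (s1 9)" "\<forall>i<t. s1 (16 + i) < B"
    using Suc.prems same[of "Suc n"] by (simp_all add: s1_def n_def)
  from Suc.IH[OF g1 this] obtain s' where s':
    "reach orc (Loop (reg 0 \<ominus> reg 9) join_prog) s1 (j * (K * bits M)) 0 s'"
    "good s'" "s' 9 = t" "s' 2 = num B s 16 t" "s' 3 = s1 3"
    unfolding same by blast
  have "val s (reg 0 \<ominus> reg 9) \<noteq> 0" using Suc.prems(1,3) by (simp add: good_def)
  from reach_trans[OF reach_Loop[OF K Suc.prems(1) this ex] s'(1)]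
  have "reach orc (Loop (reg 0 \<ominus> reg 9) join_prog) s (Suc j * (K * bits M)) 0 s'" by simp
  then show ?case using s' by (intro exI[of _ s']) (simp add: s1_def)
qed

lemma exec_base:
  assumes "good s"
  shows "exec orc base_prog s = Some (0, s(8 := B))"
proof -
  have "(D * D) * (D * D) * ((D * D) * (D * D)) = B" by (simp flip: power2_eq_square power_mult)
  then show ?thesis using goodD[OF assms] by (simp add: base_prog_def)
qed

lemma rot_prog_halts:
  assumes K1: "exec_bounded K1 init_prog" and K2: "loop_bounded K2 (reg 9) split_prog"
    and K3: "exec_bounded K3 start_prog" and K4: "loop_bounded K4 main_cond step_prog"
    and K5: "exec_bounded K5 collect_prog" and K6: "loop_bounded K6 (reg 0 \<ominus> reg 9) join_prog"
    and K7: "exec_bounded K7 output_prog"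
    and t: "1 \<le> t" and v: "v < B ^ t" and e: "e < D\<^sup>2" and BM: "B ^ t \<le> M"
  shows "\<exists>s. halts orc rot_prog (input4 t D v e) ((3 * (K1 + K2 + K3 + K4 + K5 + K6 + K7) + 6) * (t\<^sup>2 * bits M)) (2 * t\<^sup>2) s \<and>
    output2 s = rot (graph_seq H t) (v, e)"
proof -
  let ?m = "bits M"
  define s0 where "s0 = input4 t D v e"
  have s0: "good s0" "s0 2 = v" "s0 3 = e"
    using M v BM le_M(4) le_M(3)[OF e] by (auto simp: s0_def input4_def good_def)
  define s1 where "s1 = s0(8 := B, 9 := t)"
  have "exec orc init_prog s0 = Some (0, s1)"
    using goodD[OF s0(1)] by (simp add: init_prog_def exec_base[OF s0(1)] s1_def)
  note h1 = halts_exec[OF K1 s0(1) this]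
  have "good s1" "s1 8 = B" "s1 9 = t" "s1 2 < B ^ t"
    using s0 M v by (auto simp: good_def s1_def)
  moreover have s1: "s1 2 = v" "s1 3 = e" using s0 by (simp_all add: s1_def)
  ultimately obtain s2 where
    r2: "reach orc (Loop (reg 9) split_prog) s1 (t * (K2 * ?m)) 0 s2"
    and s2: "good s2" "s2 9 = 0" "num B s2 16 t = v" "\<forall>i<t. s2 (16 + i) < B" "s2 3 = e"
    using split_reach[OF K2, of s1 t] unfolding s1 by blast
  note h2 = halts_Loop[OF K2 r2 s2(1)]
  define s3 where "s3 = s2(t + 16 := 3, t + 17 := 16, t + 18 := t, 4 := t + 19)"
  have ex3: "exec orc start_prog s2 = Some (0, s3)"
    using goodD[OF s2(1)] by (simp add: start_prog_def s3_def)
  note h3 = halts_exec[OF K3 s2(1) ex3]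
  have g3: "good s3" using s2(1) M by (auto simp: good_def s3_def)
  have num3: "num B s3 16 t = v" unfolding s2(3)[symmetric] by (rule num_cong) (simp add: s3_def)
  have pre: "call_pre t 16 3 (t + 16) s3"
    using g3 s2(4,5) e t M by (simp add: call_pre_def s3_def)
  from call_reach[OF K4 t pre] obtain s4 where
    r4: "reach orc (Loop main_cond step_prog) s3 (2 * t\<^sup>2 * (K4 * ?m)) (2 * t\<^sup>2) s4"
    and post: "call_post t 16 3 (t + 16) s3 s4"
    by blast
  note post = post[unfolded call_post_def]
  have s4: "good s4" "s4 4 = t + 16" "\<forall>i<t. s4 (16 + i) < B" using post by simp_all
  have rot4: "rot (graph_seq H t) (v, e) = (num B s4 16 t, s4 3)"
    using post num3 s2(5) by (simp add: s3_def)
  have "val s4 main_cond = 0" using goodD[OF s4(1)] s4(2) by (simp add: main_cond_def)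
  note h4 = halts_Loop[OF K4 r4 s4(1) this]
  define s5 where "s5 = s4(8 := B, 2 := 0, 9 := 0)"
  have "exec orc collect_prog s4 = Some (0, s5)"
    by (simp add: collect_prog_def exec_base[OF s4(1)] s5_def)
  note h5 = halts_exec[OF K5 s4(1) this]
  have g5: "good s5" "s5 8 = B" "s5 9 + t = t" "s5 2 = num B s5 16 (s5 9)" "\<forall>i<t. s5 (16 + i) < B"
    using s4 M by (auto simp: good_def s5_def)
  have num5: "num B s5 16 t = num B s4 16 t" by (rule num_cong) (simp add: s5_def)
  have "s5 3 = s4 3" by (simp add: s5_def)
  from join_reach[OF K6 g5 BM, unfolded num5 this] obtain s6 where
    r6: "reach orc (Loop (reg 0 \<ominus> reg 9) join_prog) s5 (t * (K6 * ?m)) 0 s6"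
    and s6: "good s6" "s6 9 = t" "s6 2 = num B s4 16 t" "s6 3 = s4 3"
    by blast
  have "val s6 (reg 0 \<ominus> reg 9) = 0" using goodD[OF s6(1)] s6(2) by simp
  note h6 = halts_Loop[OF K6 r6 s6(1) this]
  define s7 where "s7 = s6(0 := s6 2, 1 := s6 3)"
  have "exec orc output_prog s6 = Some (0, s7)" by (simp add: output_prog_def s7_def)
  note h7 = halts_exec[OF K7 s6(1) this]
  have "val s2 (reg 9) = 0" using s2(2) by simp
  note h = halts_Seq[OF h1 halts_Seq[OF h2[OF this] halts_Seq[OF h3 halts_Seq[OF h4 halts_Seq[OF h5 halts_Seq[OF h6 h7]]]]]]
  have "1 \<le> ?m" using M2 bits_ge_1[of M] by simp
  then have u: "?m \<le> t\<^sup>2 * ?m" "t * ?m \<le> t\<^sup>2 * ?m" "1 \<le> t\<^sup>2 * ?m"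
    using t by (simp_all add: power2_eq_square)
  define w where "w = t\<^sup>2 * ?m"
  have b: "K * ?m \<le> K * w" "t * (K * ?m) \<le> K * w" for K
    using mult_le_mono2[OF u(1), of K] mult_le_mono2[OF u(2), of K] by (simp_all add: w_def mult_ac)
  have c: "2 * t\<^sup>2 * (K4 * ?m) = 2 * (K4 * w)" by (simp add: w_def)
  \<comment> \<open>The factor 3 comes from the main loop, which costs at most
    \<open>1 + 2 * t\<^sup>2\<close> times \<open>K4 * bits M\<close>; the other phases need at most
    2. The 6 pays for sequencing seven programs.\<close>
  have "halts orc rot_prog s0 ((3 * (K1 + K2 + K3 + K4 + K5 + K6 + K7) + 6) * w) (2 * t\<^sup>2) s7"
    unfolding rot_prog_def
  proof (rule halts_mono[OF h])
    have "(3 * (K1 + K2 + K3 + K4 + K5 + K6 + K7) + 6) * w = 3 * (K1 * w) + 3 * (K2 * w) + 3 * (K3 * w)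
        + 3 * (K4 * w) + 3 * (K5 * w) + 3 * (K6 * w) + 3 * (K7 * w) + 6 * w"
      by (simp add: algebra_simps)
    moreover have "6 \<le> 6 * w" using u(3) by (simp add: w_def)
    ultimately show "K1 * ?m + (K2 * ?m + t * (K2 * ?m) + (K3 * ?m + (K4 * ?m + 2 * t\<^sup>2 * (K4 * ?m) + (K5 * ?m +
        (K6 * ?m + t * (K6 * ?m) + K7 * ?m + 1) + 1) + 1) + 1) + 1) + 1
        \<le> (3 * (K1 + K2 + K3 + K4 + K5 + K6 + K7) + 6) * w"
      unfolding c using b(1)[of K1] b[of K2] b(1)[of K3] b(1)[of K4] b(1)[of K5] b[of K6] b(1)[of K7]
      by linarith
  qed simp
  moreover have "output2 s7 = rot (graph_seq H t) (v, e)"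
    by (simp add: output2_def s7_def s6 rot4)
  ultimately show ?thesis unfolding s0_def w_def by blast
qed

end

text \<open>The number is at most \<open>D ^ (8 * t) * 2 ^ (20 * t + 21)\<close>. Its logarithm plus
  1 is at most 8 t log D + 20 t + 22, and 20 t + 22 \<le> 42 t.\<close>

lemma bits_log_le:
  assumes D: "1 \<le> D" and t: "1 \<le> t"
  shows "real (bits (D ^ (8 * t) + 20 * t + 20)) \<le> 42 * real t * (log 2 (real D) + 1)"
proof -
  define n where "n = D ^ (8 * t) + 20 * t + 20"
  have L: "0 \<le> log 2 (real D)" using D by simp
  have "20 * t + 20 \<le> D ^ (8 * t) * (20 * t + 20)" using D by simp
  then have "n \<le> D ^ (8 * t) * (20 * t + 21)" by (simp add: n_def algebra_simps)
  also have "20 * t + 21 \<le> (2 :: nat) ^ (20 * t + 21)" by (rule less_imp_le[OF less_exp])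
  finally have "real n \<le> real (D ^ (8 * t) * 2 ^ (20 * t + 21))"
    unfolding of_nat_le_iff by simp
  moreover have "0 < n" by (simp add: n_def)
  ultimately have "log 2 (real n) \<le> log 2 (real (D ^ (8 * t) * 2 ^ (20 * t + 21)))"
    by (intro log_mono) auto
  also have "\<dots> = real (8 * t) * log 2 (real D) + real (20 * t + 21)"
    using D by (simp add: log_mult log_nat_power)
  finally have "log 2 (real n) \<le> 8 * real t * log 2 (real D) + 20 * real t + 21" by simp
  moreover have "real (bits n) \<le> log 2 (real n) + 1"
    using \<open>0 < n\<close> by (simp add: floorlog_def)
  moreover have "0 \<le> real t * log 2 (real D)" using L by simp
  moreover have "1 \<le> real t" using t by simp
  ultimately show ?thesis
    unfolding n_def[symmetric] distrib_left by simp
qed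

theorem theorem3p3:
  "\<exists>C::real. C > 0 \<and>
    (\<exists>(alg :: prog) (p :: real poly poly) (q :: real poly).
      \<forall>(H :: rgraph) (D :: nat) (l :: real). ndl_graph (D ^ 8) D l H \<longrightarrow>
        (\<forall>t::nat. t \<ge> 1 \<longrightarrow>
          (\<exists>l_t. l_t \<le> l + C * l ^ 2 \<and>
             ndl_graph (D ^ (8 * t)) (D ^ 2) l_t (graph_seq H t)) \<and>
          (\<forall>(v, i) \<in> rdom (graph_seq H t).
             \<exists>T Q s. run (rot_oracle H) alg (input4 t D v i) T Q s \<and>
               output2 s = rot (graph_seq H t) (v, i) \<and>
               real T \<le> poly2 p (real t) (log 2 (real D)) \<and>
               real Q \<le> poly q (real t))))"
proof -
  \<comment> \<open>These constants depend on the programs only, so the polynomials are fixed before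
    \<open>H\<close>, \<open>D\<close> and \<open>t\<close>.\<close>
  obtain K1 K2 K3 K4 K5 K6 K7 where K: "exec_bounded K1 init_prog" "loop_bounded K2 (reg 9) split_prog"
    "exec_bounded K3 start_prog" "loop_bounded K4 main_cond step_prog"
    "exec_bounded K5 collect_prog" "loop_bounded K6 (reg 0 \<ominus> reg 9) join_prog"
    "exec_bounded K7 output_prog"
    using exec_bounded_exists loop_bounded_exists by metis
  define C where "C = 3 * (K1 + K2 + K3 + K4 + K5 + K6 + K7) + 6"
  define A where "A = real C * 42"
  \<comment> \<open>The value of \<open>p\<close> at t and log D is A t^3 (1 + log D): t^2 from the
    number of iterations, the remaining factor t (1 + log D) from the bit length.\<close>
  define p where "p = monom [:A, A:] 3"
  define q where "q = monom (2 :: real) 2"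
  have alg: "\<exists>T Q s. run (rot_oracle H) rot_prog (input4 t D v i) T Q s \<and>
      output2 s = rot (graph_seq H t) (v, i) \<and>
      real T \<le> poly2 p (real t) (log 2 (real D)) \<and> real Q \<le> poly q (real t)"
    if H: "ndl_graph (D ^ 8) D l H" and t: "1 \<le> t" and vi: "(v, i) \<in> rdom (graph_seq H t)"
    for H D l t v i
  proof -
    have rg: "regular_graph H" "nv H = D ^ 8" "deg H = D" using H by (simp_all add: ndl_graph_iff)
    then have D: "1 \<le> D" by (auto simp: regular_graph_def)
    \<comment> \<open>Input and output vertices occupy a single cell, so \<open>M\<close> must reach
      \<open>D ^ (8 * t)\<close> and not just one digit.\<close>
    define M where "M = D ^ (8 * t) + 20 * t + 20"
    have "D ^ 8 \<le> D ^ (8 * t)" using D t by (intro power_increasing) auto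
    then interpret machine H D t M
      using rg D by unfold_locales (auto simp: M_def)
    have "v < (D ^ 8) ^ t" "i < D\<^sup>2" "(D ^ 8) ^ t \<le> M"
      using vi graph_seq_regular[OF rg t] by (simp_all add: rdom_def M_def power_mult)
    from rot_prog_halts[OF K t this] obtain T Q s where
      "run (rot_oracle H) rot_prog (input4 t D v i) T Q s" "output2 s = rot (graph_seq H t) (v, i)"
      and T: "T \<le> C * (t\<^sup>2 * bits M)" and Q: "Q \<le> 2 * t\<^sup>2"
      unfolding halts_def C_def by blast
    moreover have "real Q \<le> poly q (real t)"
      using of_nat_mono[OF Q, where 'a = real] by (simp add: q_def poly_monom)
    moreover have "real T \<le> real C * ((real t)\<^sup>2 * real (bits M))"
      using of_nat_mono[OF T, where 'a = real] by simp
    then have "real T \<le> real C * ((real t)\<^sup>2 * (42 * real t * (log 2 (real D) + 1)))"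
      using bits_log_le[OF D t] unfolding M_def
      by (elim order_trans) (intro mult_left_mono; simp)
    then have "real T \<le> poly2 p (real t) (log 2 (real D))"
      by (simp add: poly2_def p_def poly_monom A_def algebra_simps power2_eq_square power3_eq_cube)
    ultimately show ?thesis by blast
  qed
  show ?thesis
  proof (rule exI[of _ 20], rule conjI, simp, rule exI[of _ rot_prog], rule exI[of _ p], rule exI[of _ q],
      intro allI impI, rule conjI)
    fix H D l and t :: nat assume H: "ndl_graph (D ^ 8) D l H" and t: "1 \<le> t"
    show "\<exists>l_t. l_t \<le> l + 20 * l ^ 2 \<and> ndl_graph (D ^ (8 * t)) (D ^ 2) l_t (graph_seq H t)"
      by (rule graph_seq_ndl[OF H t])
    show "\<forall>(v, i) \<in> rdom (graph_seq H t). \<exists>T Q s. run (rot_oracle H) rot_prog (input4 t D v i) T Q s \<and>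
        output2 s = rot (graph_seq H t) (v, i) \<and>
        real T \<le> poly2 p (real t) (log 2 (real D)) \<and> real Q \<le> poly q (real t)"
      using alg[OF H t] by blast
  qed
qed

end
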